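(* Let $p>2$ be a prime, and let $F$, $K$, $a$, $\xi_p$, $G=\langle\sigma\rangle$, $J$ and $N$ be as in the context. Then, as an $\mathbb{F}_p[G]$-module, $J$ decomposes as an internal direct sum $$J = X\oplus Y\oplus Z,$$ where (1) $X$ is an indecomposable $\mathbb{F}_p[G]$-submodule, of $\mathbb{F}_p$-dimension $1$ if $\xi_p\in N(K^\times)$ and of dimension $2$ if $\xi_p\notin N(K^\times)$; (2) $Y$ is a free $\mathbb{F}_p[G]$-submodule with $Y^G=N(J)$; (3) $Z$ is a trivial $\mathbb{F}_p[G]$-module (i.e. $G$ acts trivially on $Z$). Moreover, the rank of any maximal free $\mathbb{F}_p[G]$-submodule of $J$ equals $\dim_{\mathbb{F}_p} N(J)$.
   Context: Let $p$ be a prime and $F$ a field of characteristic different from $p$ containing a primitive $p$th root of unity $\xi_p$. Let $a\in F^\times\setminus F^{\times p}$ and $K=F(\sqrt[p]{a})$, a cyclic extension of degree $p$; $K^\times=K\setminus\{0\}$. Let $G=\mathrm{Gal}(K/F)=\langle\sigma\rangle$, where $\sigma(\sqrt[p]{a})/\sqrt[p]{a}=\xi_p$. Let $J=K^\times/K^{\times p}$, an $\mathbb{F}_p[G]$-module (written multiplicatively or additively; elements denoted $[\gamma]$, $\gamma\in K^\times$). For a $G$-module $V$, $V^G$ denotes the submodule of $G$-fixed elements. Let $N=1+\sigma+\dots+\sigma^{p-1}\in\mathbb{F}_p[G]$, also viewed as the endomorphism of $J$ it induces; $N(J)$ is its image. $N(K^\times)\subseteq F^\times$ denotes the group of norms from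 $K$ to $F$. *)

theory Defs
  imports Main "HOL-Library.Equipollence" "HOL-Computational_Algebra.Primes"
begin

(* F is a subfield of the ambient field 'k (which plays the role of K) *)
definition is_subfield :: "'k::field set \<Rightarrow> bool" where
  "is_subfield L \<longleftrightarrow> 0 \<in> L \<and> 1 \<in> L \<and> (\<forall>x\<in>L. \<forall>y\<in>L. x + y \<in> L \<and> x * y \<in> L)
     \<and> (\<forall>x\<in>L. - x \<in> L) \<and> (\<forall>x\<in>L. x \<noteq> 0 \<longrightarrow> inverse x \<in> L)"

definition field_aut :: "('k::field \<Rightarrow> 'k) \<Rightarrow> bool" where
  "field_aut s \<longleftrightarrow> bij s \<and> (\<forall>x y. s (x + y) = s x + s y) \<and> (\<forall>x y. s (x * y) = s x * s y) \<and> s 1 = 1"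

definition pcl :: "nat \<Rightarrow> 'k::field \<Rightarrow> 'k set" where
  "pcl p g = {g * d ^ p | d. d \<noteq> 0}"

definition Jmod :: "nat \<Rightarrow> 'k::field set set" where
  "Jmod p = {pcl p g | g. g \<noteq> 0}"

definition jmul :: "'k::field set \<Rightarrow> 'k set \<Rightarrow> 'k set" where
  "jmul A B = {x * y | x y. x \<in> A \<and> y \<in> B}"

definition setmul :: "'k::field set set \<Rightarrow> 'k set set \<Rightarrow> 'k set set" where
  "setmul M1 M2 = {jmul A B | A B. A \<in> M1 \<and> B \<in> M2}"

definition submod :: "nat \<Rightarrow> ('k::field \<Rightarrow> 'k) \<Rightarrow> 'k set set \<Rightarrow> bool" where
  "submod p s M \<longleftrightarrow> M \<subseteq> Jmod p \<and> pcl p 1 \<in> M \<and> (\<forall>A\<in>M. \<forall>B\<in>M. jmul A B \<in> M)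
     \<and> (\<forall>A\<in>M. s ` A \<in> M)"

definition idsum :: "nat \<Rightarrow> 'k::field set set \<Rightarrow> 'k set set \<Rightarrow> 'k set set \<Rightarrow> bool" where
  "idsum p M1 M2 M \<longleftrightarrow> M1 \<inter> M2 = {pcl p 1} \<and> setmul M1 M2 = M"

definition indecomposable :: "nat \<Rightarrow> ('k::field \<Rightarrow> 'k) \<Rightarrow> 'k set set \<Rightarrow> bool" where
  "indecomposable p s X \<longleftrightarrow> submod p s X \<and> X \<noteq> {pcl p 1} \<and>
     (\<forall>M1 M2. submod p s M1 \<and> submod p s M2 \<and> idsum p M1 M2 X \<longrightarrow>
        M1 = {pcl p 1} \<or> M2 = {pcl p 1})"

definition supp2 :: "('k \<Rightarrow> nat \<Rightarrow> nat) \<Rightarrow> 'k set" where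
  "supp2 c = {b. \<exists>i. c b i \<noteq> 0}"

(* coefficient families: to each b \<in> B an element sum_{i<p} c b i sigma^i of F_p[G],
   finitely many nonzero *)
definition gcoeffs :: "nat \<Rightarrow> 'k set \<Rightarrow> ('k \<Rightarrow> nat \<Rightarrow> nat) set" where
  "gcoeffs p B = {c. (\<forall>b i. c b i < p) \<and> (\<forall>b i. p \<le> i \<longrightarrow> c b i = 0)
      \<and> finite (supp2 c) \<and> supp2 c \<subseteq> B}"

(* representative of the F_p[G]-linear combination  prod_b (sum_i c b i sigma^i) [b] *)
definition gcomb :: "nat \<Rightarrow> ('k::field \<Rightarrow> 'k) \<Rightarrow> ('k \<Rightarrow> nat \<Rightarrow> nat) \<Rightarrow> 'k" where
  "gcomb p s c = (\<Prod>b\<in>supp2 c. \<Prod>i<p. ((s ^^ i) b) ^ (c b i))"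

definition free_basis :: "nat \<Rightarrow> ('k::field \<Rightarrow> 'k) \<Rightarrow> 'k set \<Rightarrow> 'k set set \<Rightarrow> bool" where
  "free_basis p s B Y \<longleftrightarrow> 0 \<notin> B \<and> bij_betw (\<lambda>c. pcl p (gcomb p s c)) (gcoeffs p B) Y"

definition free_submod :: "nat \<Rightarrow> ('k::field \<Rightarrow> 'k) \<Rightarrow> 'k set set \<Rightarrow> bool" where
  "free_submod p s Y \<longleftrightarrow> submod p s Y \<and> (\<exists>B. free_basis p s B Y)"

definition fcoeffs :: "nat \<Rightarrow> 'k set \<Rightarrow> ('k \<Rightarrow> nat) set" where
  "fcoeffs p B = {c. (\<forall>b. c b < p) \<and> finite {b. c b \<noteq> 0} \<and> {b. c b \<noteq> 0} \<subseteq> B}"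

definition fcomb :: "('k::field \<Rightarrow> nat) \<Rightarrow> 'k" where
  "fcomb c = (\<Prod>b\<in>{b. c b \<noteq> 0}. b ^ c b)"

definition fp_basis :: "nat \<Rightarrow> 'k::field set \<Rightarrow> 'k set set \<Rightarrow> bool" where
  "fp_basis p B V \<longleftrightarrow> 0 \<notin> B \<and> bij_betw (\<lambda>c. pcl p (fcomb c)) (fcoeffs p B) V"

definition fp_dim_eq :: "nat \<Rightarrow> 'k::field set set \<Rightarrow> nat \<Rightarrow> bool" where
  "fp_dim_eq p V d \<longleftrightarrow> (\<exists>B. fp_basis p B V \<and> finite B \<and> card B = d)"

definition knorm :: "nat \<Rightarrow> ('k::field \<Rightarrow> 'k) \<Rightarrow> 'k \<Rightarrow> 'k" where
  "knorm p s g = (\<Prod>i<p. (s ^^ i) g)"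

definition NJ :: "nat \<Rightarrow> ('k::field \<Rightarrow> 'k) \<Rightarrow> 'k set set" where
  "NJ p s = {pcl p (knorm p s g) | g. g \<noteq> 0}"

definition fixedpart :: "('k \<Rightarrow> 'k) \<Rightarrow> 'k set set \<Rightarrow> 'k set set" where
  "fixedpart s M = {A \<in> M. s ` A = A}"

end

theory Submission
  imports Defs "HOL-Computational_Algebra.Polynomial" "HOL-Algebra.Free_Abelian_Groups"
begin

text \<open>
  Write \<open>t = \<sigma> - 1\<close>, so that \<open>N = t\<^sup>p\<^sup>-\<^sup>1\<close> on \<open>J\<close>. If \<open>N[x] = 0\<close>, then the norm of \<open>x\<close> is a
  \<open>p\<close>-th power in \<open>K\<close>, hence by Kummer theory the norm of some \<open>\<alpha>\<^sup>i g\<close> with \<open>g \<in> F\<close>, and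
  Hilbert 90 yields \<open>[x] = i[\<alpha>] + [g] + t[w]\<close>. Since \<open>t[\<alpha>] = [\<xi>]\<close> and \<open>t[g] = 0\<close>, a chain of length
  \<open>l \<ge> 3\<close> under \<open>t\<close> can be prolonged without changing its last element; hence that last element
  lies in \<open>N(J)\<close>, while a chain of length 2 ends in \<open>N(J) + \<langle>[\<xi>]\<rangle>\<close>.
  Elements whose norms form a basis of \<open>N(J)\<close> generate a free module \<open>Y\<close> with \<open>Y\<^sup>G = N(J)\<close>.
  If \<open>\<xi>\<close> is not a norm, take \<open>X = \<langle>[\<alpha>], [\<xi>]\<rangle>\<close>; if \<open>\<xi> = N(\<delta>)\<close>, take \<open>X = \<langle>[\<gamma>]\<rangle>\<close>, where
  \<open>\<sigma>(\<gamma>)/\<gamma> = \<delta>\<^sup>p\<close>. With \<open>Z\<close> a complement of \<open>N(J) + X\<^sup>G\<close> in \<open>J\<^sup>G\<close>, the sum of \<open>X\<close>, \<open>Y\<close>, \<open>Z\<close> is direct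
  because the sum of their fixed parts is, and it is all of \<open>J\<close>
    by induction on the length of chains.
\<close>

section \<open>The integral group ring modulo \<open>p\<close>\<close>

text \<open>The group ring never occurs as a type: Z[X] acts on the units of K with X acting as
  \<open>\<sigma>\<close>, and every statement about J becomes a congruence modulo p-th powers. What
  keeps J from being free plus trivial is the single class \<open>[\<alpha>]\<close>: the chain
  \<open>\<alpha>\<close>, \<open>\<xi>\<close> of length 2 ends in N(J) only if
  \<open>\<xi>\<close> is a norm. If it is, this chain is absorbed by Y and the fixed classes, and X
  has another task: it must be a nonzero line, so a fixed class outside N(J) has to be exhibited.
  This is \<open>[\<gamma>]\<close>; were it in N(J), comparing p-th roots would give
  \<open>N(\<delta>) = 1\<close> instead of \<open>\<xi>\<close>. Oddness of p gives
  \<open>N(\<alpha>) = a\<close> rather than \<open>-a\<close>, and p at least 3 leaves room for the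
  chain of length 3 to which chains of length 2 are reduced. J may be infinite-dimensional: bases
  come from Zorn's lemma, and the equality of rank and dimension is one of cardinals.\<close>

definition norm_poly :: "nat \<Rightarrow> int poly" where
  "norm_poly p = (\<Sum>i<p. monom 1 i)"

text \<open>The kernel of the map from Z[X] to F_p[G] that sends X to \<open>\<sigma>\<close>.
  Computing with integer polynomials modulo this ideal avoids constructing the quotient
  ring.\<close>

definition relation_ideal :: "nat \<Rightarrow> int poly set" where
  "relation_ideal p = {(monom 1 p - 1) * g + [:int p:] * h | g h. True}"

lemma X_minus_1_times_norm_poly: "[:-1, 1:] * norm_poly p = monom 1 p - 1"
proof (induction p)
  case (Suc p)
  have "[:-1, 1:] * norm_poly (Suc p) = [:-1, 1:] * norm_poly p + [:-1, 1:] * monom 1 p"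
    by (simp add: norm_poly_def algebra_simps)
  also have "\<dots> = monom 1 (Suc p) - 1"
    unfolding Suc.IH by (simp add: monom_Suc)
  finally show ?case .
qed (simp add: norm_poly_def one_pCons)

text \<open>Division by \<open>X - 1\<close>. The remainder \<open>poly f 1\<close> is the
  augmentation of \<open>f\<close>, the scalar by which \<open>f\<close> acts on everything that
  \<open>t\<close> kills.\<close>

lemma poly_split_at_1: "\<exists>g. f = [:poly f 1:] + [:-1, 1:] * g" for f :: "int poly"
  using synthetic_div_correct'[of 1 f] by (metis add.commute)

text \<open>\<open>X - 1\<close> is not a zero divisor modulo \<open>p\<close>: evaluating at 1
  gives \<open>p * h(1) = 0\<close>, so \<open>h\<close> is itself a multiple of
  \<open>X - 1\<close> and the factor cancels over the integers.\<close>

lemma cancel_X_minus_1_mod: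
  fixes f g :: "int poly"
  assumes "prime p" and "[:-1, 1:] * f = [:-1, 1:] * g + [:int p:] * h"
  shows "\<exists>h'. f = g + [:int p:] * h'"
proof -
  have "poly ([:-1, 1:] * f) 1 = poly ([:-1, 1:] * g + [:int p:] * h) 1"
    using assms(2) by simp
  hence "poly h 1 = 0"
    using prime_gt_0_nat[OF assms(1)] by simp
  then obtain k where k: "h = [:-1, 1:] * k"
    using poly_split_at_1[of h] by auto
  have "[:-1, 1:] * f = [:-1, 1:] * (g + [:int p:] * k)"
    unfolding assms(2) k by (simp only: distrib_left mult.left_commute)
  hence "f = g + [:int p:] * k"
    by (subst (asm) mult_left_cancel) auto
  thus ?thesis by blast
qed

text \<open>Frobenius modulo \<open>p\<close>: the inner binomial coefficients are multiples of
  \<open>p\<close>, and oddness gives the constant term its sign.\<close>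

lemma X_minus_1_power_prime:
  assumes "prime p" "odd p"
  shows "\<exists>h. [:-1, 1:] ^ p = (monom 1 p - 1) + [:int p:] * h"
proof -
  have p: "p > 0" using assms(1) by (simp add: prime_gt_0_nat)
  let ?f = "\<lambda>k. of_nat (p choose k) * monom 1 1 ^ k * (- 1 :: int poly) ^ (p - k)"
  have e: "[:-1, 1:] = monom (1::int) 1 + (-1)"
    by (simp add: monom_Suc one_pCons)
  have "[:-1, 1:] ^ p = (\<Sum>k\<le>p. ?f k)"
    unfolding e by (rule binomial_ring)
  also have "{..p} = insert 0 (insert p {1..<p})" using p by auto
  also have "sum ?f \<dots> = ?f 0 + (?f p + sum ?f {1..<p})"
    using p by (subst sum.insert; simp)+
  also have "?f 0 = -1" using assms(2) by simp
  also have "?f p = monom 1 p" by (simp add: monom_power)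
  finally have eq: "[:-1, 1:] ^ p = (monom 1 p - 1) + sum ?f {1..<p}" by simp
  have "[:int p:] dvd sum ?f {1..<p}"
  proof (rule dvd_sum)
    fix k assume "k \<in> {1..<p}"
    hence "p dvd (p choose k)"
      using assms(1) by (intro dvd_choose_prime) auto
    hence "of_nat p dvd (of_nat (p choose k) :: int poly)"
      by (metis dvd_def of_nat_mult)
    hence "[:int p:] dvd (of_nat (p choose k) :: int poly)"
      by (simp only: of_nat_poly of_nat_id)
    thus "[:int p:] dvd ?f k" by (intro dvd_mult2)
  qed
  then obtain h where "sum ?f {1..<p} = [:int p:] * h" by (elim dvdE)
  with eq show ?thesis by (intro exI[of _ h]) (simp only:)
qed

text \<open>Both \<open>(X - 1) ^ p\<close> and \<open>X - 1\<close> times the norm polynomial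
  reduce to \<open>X ^ p - 1\<close>, so a factor \<open>X - 1\<close> cancels modulo
  \<open>p\<close>. This makes N(J) the set of ends of chains of full length
  \<open>p\<close>.\<close>

lemma X_minus_1_power_prime_minus_1:
  assumes "prime p" "odd p"
  shows "\<exists>h. [:-1, 1:] ^ (p - 1) = norm_poly p + [:int p:] * h"
proof -
  obtain h where h: "[:-1, 1:] ^ p = (monom 1 p - 1) + [:int p:] * h"
    using X_minus_1_power_prime[OF assms] by blast
  have "[:-1, 1:] ^ p = [:-1, 1:] * ([:-1, 1:] :: int poly) ^ (p - 1)"
    using prime_gt_0_nat[OF assms(1)] by (cases p) auto
  thus ?thesis
    using h X_minus_1_times_norm_poly[of p] cancel_X_minus_1_mod[OF assms(1)] by metis
qed

lemma relation_ideal_add: "f \<in> relation_ideal p \<Longrightarrow> g \<in> relation_ideal p \<Longrightarrow> f + g \<in> relation_ideal p"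
proof -
  assume "f \<in> relation_ideal p" "g \<in> relation_ideal p"
  then obtain u v u' v' where "f = (monom 1 p - 1) * u + [:int p:] * v"
      "g = (monom 1 p - 1) * u' + [:int p:] * v'"
    unfolding relation_ideal_def by blast
  hence "f + g = (monom 1 p - 1) * (u + u') + [:int p:] * (v + v')"
    by (simp only: distrib_left add_ac)
  thus ?thesis unfolding relation_ideal_def by blast
qed

lemma relation_ideal_mult: "f \<in> relation_ideal p \<Longrightarrow> g * f \<in> relation_ideal p"
proof -
  assume "f \<in> relation_ideal p"
  then obtain u v where "f = (monom 1 p - 1) * u + [:int p:] * v"
    unfolding relation_ideal_def by blast
  hence "g * f = (monom 1 p - 1) * (g * u) + [:int p:] * (g * v)"
    by (simp only: distrib_left mult.left_commute)
  thus ?thesis unfolding relation_ideal_def by blast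
qed

lemma const_in_relation_ideal: "int p dvd k \<Longrightarrow> [:k:] \<in> relation_ideal p"
proof -
  assume "int p dvd k"
  then obtain m where "k = int p * m" by blast
  hence "[:k:] = (monom 1 p - 1) * 0 + [:int p:] * [:m:]" by simp
  thus ?thesis unfolding relation_ideal_def by blast
qed

text \<open>Uniqueness of reduced representatives. Vanishing of \<open>f\<close> from degree
  \<open>p\<close> on forces the coefficients of \<open>g\<close> to agree modulo \<open>p\<close>
  along steps of length \<open>p\<close>; far out they are 0, so all of them are multiples of
  \<open>p\<close>.\<close>

lemma relation_ideal_coeff_dvd:
  assumes p: "p > 0" and f: "f \<in> relation_ideal p" and deg: "\<And>i. i \<ge> p \<Longrightarrow> coeff f i = 0"
  shows "int p dvd coeff f i"
proof -
  obtain g h where fgh: "f = (monom 1 p - 1) * g + [:int p:] * h"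
    using f unfolding relation_ideal_def by blast
  have cf: "coeff f i = (if i < p then 0 else coeff g (i - p)) - coeff g i + int p * coeff h i" for i
    unfolding fgh by (simp add: left_diff_distrib coeff_monom_mult)
  have shift: "int p dvd coeff g (j + p) - coeff g j" for j
  proof -
    have "coeff g (j + p) - coeff g j = int p * coeff h (j + p)"
      using cf[of "j + p"] deg[of "j + p"] by simp
    thus ?thesis by simp
  qed
  have steps: "int p dvd coeff g (j + n * p) - coeff g j" for j n
  proof (induction n)
    case (Suc n)
    from dvd_add[OF shift[of "j + n * p"] Suc.IH] show ?case
      by (simp add: algebra_simps)
  qed simp
  have g: "int p dvd coeff g j" for j
  proof -
    have "degree g < j + Suc (degree g) * p"
      using p by (cases p) auto
    hence "coeff g (j + Suc (degree g) * p) = 0"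
      by (rule coeff_eq_0)
    thus ?thesis using steps[of j "Suc (degree g)"] by simp
  qed
  show ?thesis unfolding cf by (auto intro!: dvd_add dvd_diff g)
qed

text \<open>Existence of reduced representatives. With the preceding lemma, F_p[G] is coded by
  polynomials of degree below \<open>p\<close> with coefficients from 0 to \<open>p - 1\<close>,
  which is the coding in \<open>gcoeffs\<close>.\<close>

lemma relation_ideal_reduce:
  assumes p: "p > 0"
  shows "\<exists>r. f - r \<in> relation_ideal p \<and> (\<forall>i. 0 \<le> coeff r i \<and> coeff r i < int p) \<and> (\<forall>i\<ge>p. coeff r i
      = 0)"
proof -
  have "\<exists>r. f - r \<in> relation_ideal p \<and> (\<forall>i\<ge>p. coeff r i = 0)"
  proof (induction f)
    case 0
    show ?case using const_in_relation_ideal[of p 0] by (intro exI[of _ 0]) auto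
  next
    case (pCons c f)
    then obtain r where r: "f - r \<in> relation_ideal p" "\<And>i. i \<ge> p \<Longrightarrow> coeff r i = 0" by blast
    \<comment> \<open>\<open>l\<close> is the coefficient that multiplication by X pushes to degree
      \<open>p\<close>; subtracting \<open>l * (X ^ p - 1)\<close> wraps it round to the constant
      term.\<close>
    define l where "l = coeff r (p - 1)"
    define r' where "r' = pCons c r - smult l (monom 1 p - 1)"
    have "pCons c f - r' = [:0, 1:] * (f - r) + [:l:] * (monom 1 p - 1)"
      unfolding r'_def by simp
    moreover have "monom 1 p - 1 \<in> relation_ideal p"
      unfolding relation_ideal_def by (intro CollectI exI[of _ 1] exI[of _ 0]) simp
    ultimately have "pCons c f - r' \<in> relation_ideal p"
      using r(1) by (simp only: relation_ideal_add relation_ideal_mult)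
    moreover have "coeff r' i = 0" if "i \<ge> p" for i
      using that p r(2) unfolding r'_def l_def
      by (cases i) (auto simp: coeff_pCons not_less_eq_eq le_Suc_eq)
    ultimately show ?case by blast
  qed
  then obtain r where r: "f - r \<in> relation_ideal p" "\<And>i. i \<ge> p \<Longrightarrow> coeff r i = 0" by blast
  define r' where "r' = map_poly (\<lambda>x. x mod int p) r"
  have c: "coeff r' i = coeff r i mod int p" for i
    unfolding r'_def by (simp add: coeff_map_poly)
  have "r = r' + [:int p:] * map_poly (\<lambda>x. x div int p) r"
    by (rule poly_eqI) (simp add: c coeff_map_poly)
  hence "r - r' = (monom 1 p - 1) * 0 + [:int p:] * map_poly (\<lambda>x. x div int p) r"
    by (metis add_diff_cancel_left' mult_zero_right add_0)
  hence "r - r' \<in> relation_ideal p" unfolding relation_ideal_def by blast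
  from relation_ideal_add[OF r(1) this] have "f - r' \<in> relation_ideal p" by simp
  thus ?thesis using c r(2) p by (intro exI[of _ r']) auto
qed

section \<open>Modules over the group ring\<close>

text \<open>Tukey's lemma: a finite subset of the union of a nonempty chain already lies in one
  member, so Zorn's lemma applies. Independence is a property of this kind.\<close>

lemma maximal_set_finite_char:
  assumes "Q {}"
    and "\<And>A. Q A \<longleftrightarrow> (\<forall>S. finite S \<and> S \<subseteq> A \<longrightarrow> Q S)"
  shows "\<exists>M. Q M \<and> (\<forall>A. Q A \<and> M \<subseteq> A \<longrightarrow> A = M)"
proof -
  have "\<exists>M\<in>{A. Q A}. \<forall>A\<in>{A. Q A}. M \<subseteq> A \<longrightarrow> A = M"
  proof (rule subset_Zorn_nonempty)
    show "{A. Q A} \<noteq> {}" using assms(1) by blast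
    fix C assume C: "C \<noteq> {}" "subset.chain {A. Q A} C"
    have "Q S" if "finite S" "S \<subseteq> \<Union>C" for S
    proof -
      from that C obtain A where "A \<in> C" "S \<subseteq> A"
        by (rule finite_subset_Union_chain)
      thus ?thesis using C(2) assms(2)[of A] that(1) by (auto simp: subset_chain_def)
    qed
    thus "\<Union>C \<in> {A. Q A}" using assms(2)[of "\<Union>C"] by blast
  qed
  thus ?thesis by blast
qed

lemma coprime_prime_int: "prime p \<Longrightarrow> \<not> int p dvd k \<Longrightarrow> \<exists>m. int p dvd m * k - 1"
proof -
  assume "prime p" "\<not> int p dvd k"
  hence "coprime (int p) k" by (intro prime_imp_coprime) auto
  then obtain x y where "x * int p + y * k = 1"
    using bezout_int[of "int p" k] by auto
  hence "y * k - 1 = int p * (- x)" by (simp add: algebra_simps)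
  thus ?thesis by (metis dvd_triv_left)
qed

text \<open>The module acted upon is \<open>K\<^sup>\<times>\<close> rather than the quotient \<open>J\<close>:
  \<open>P\<close> stands for \<open>K\<^sup>\<times>\<^sup>p\<close>, and submodules of \<open>J\<close> are the subspaces containing \<open>P\<close>.\<close>

locale group_ring_module = module act
  for act :: "int poly \<Rightarrow> 'a::ab_group_add \<Rightarrow> 'a" (infixr \<open>\<bullet>\<close> 75) +
  fixes p :: nat and P :: "'a set"
  assumes prime_p: "prime p" and odd_p: "odd p"
    and subspace_P: "subspace P"
    and p_act: "[:int p:] \<bullet> x \<in> P"
    and cyclic_act: "(monom 1 p - 1) \<bullet> x \<in> P"
begin

abbreviation t :: "int poly" where "t \<equiv> [:-1, 1:]"
abbreviation norm :: "int poly" where "norm \<equiv> norm_poly p"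

lemmas P_0 = subspace_0[OF subspace_P]
  and P_add = subspace_add[OF subspace_P]
  and P_diff = subspace_diff[OF subspace_P]
  and P_neg = subspace_neg[OF subspace_P]
  and P_act = subspace_scale[OF subspace_P]
  and P_sum = subspace_sum[OF subspace_P]

lemma p_pos: "p > 0" using prime_p by (rule prime_gt_0_nat)

lemma relation_ideal_act:
  assumes "f \<in> relation_ideal p"
  shows "f \<bullet> x \<in> P"
proof -
  obtain g h where "f = (monom 1 p - 1) * g + [:int p:] * h"
    using assms unfolding relation_ideal_def by blast
  hence "f \<bullet> x = (monom 1 p - 1) \<bullet> (g \<bullet> x) + [:int p:] \<bullet> (h \<bullet> x)"
    by (simp only: scale_left_distrib scale_scale)
  thus ?thesis by (simp only: P_add cyclic_act p_act)
qed

lemma multiple_act: "int p dvd k \<Longrightarrow> [:k:] \<bullet> x \<in> P"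
  by (rule relation_ideal_act[OF const_in_relation_ideal])

lemma t_power_norm: "t ^ (p - 1) \<bullet> x - norm \<bullet> x \<in> P"
proof -
  obtain h where "t ^ (p - 1) = norm + [:int p:] * h"
    using X_minus_1_power_prime_minus_1[OF prime_p odd_p] by blast
  hence "t ^ (p - 1) \<bullet> x - norm \<bullet> x = [:int p:] \<bullet> (h \<bullet> x)"
    by (simp only: scale_left_distrib scale_scale) simp
  thus ?thesis by (simp only: p_act)
qed

lemma t_power_p: "t ^ p \<bullet> x \<in> P"
proof -
  obtain h where "t ^ p = (monom 1 p - 1) + [:int p:] * h"
    using X_minus_1_power_prime[OF prime_p odd_p] by blast
  hence "t ^ p \<bullet> x = (monom 1 p - 1) \<bullet> x + [:int p:] \<bullet> (h \<bullet> x)"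
    by (simp only: scale_left_distrib scale_scale)
  thus ?thesis by (simp only: P_add cyclic_act p_act)
qed

lemma t_norm: "t \<bullet> (norm \<bullet> x) \<in> P"
  by (simp only: scale_scale X_minus_1_times_norm_poly cyclic_act)

section \<open>The preimages of J^G and N(J)\<close>

definition fixed :: "'a set" where "fixed = {x. t \<bullet> x \<in> P}"

definition norms :: "'a set" where "norms = {x. \<exists>y. x - norm \<bullet> y \<in> P}"

lemma subspace_fixed: "subspace fixed"
proof (rule subspaceI)
  fix f x assume "x \<in> fixed"
  hence "f \<bullet> (t \<bullet> x) \<in> P" by (simp only: fixed_def mem_Collect_eq P_act)
  thus "f \<bullet> x \<in> fixed" by (simp only: fixed_def mem_Collect_eq scale_left_commute)
qed (simp_all only: fixed_def mem_Collect_eq scale_right_distrib scale_zero_right P_add P_0)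

text \<open>\<open>f - f(1)\<close> is a multiple of \<open>t\<close>, so on fixed classes the group
  ring acts through its augmentation.\<close>

lemma act_fixed:
  assumes "x \<in> fixed"
  shows "f \<bullet> x - [:poly f 1:] \<bullet> x \<in> P"
proof -
  obtain g where "f = [:poly f 1:] + t * g" using poly_split_at_1 by blast
  hence "f \<bullet> x = ([:poly f 1:] + g * t) \<bullet> x" by (metis mult.commute)
  hence "f \<bullet> x - [:poly f 1:] \<bullet> x = g \<bullet> (t \<bullet> x)"
    by (simp only: scale_left_distrib scale_scale) simp
  thus ?thesis using assms by (simp only: fixed_def mem_Collect_eq P_act)
qed

lemma norm_fixed: "norm \<bullet> x \<in> fixed"
  by (simp only: fixed_def mem_Collect_eq t_norm)

lemma act_norm: "f \<bullet> (norm \<bullet> x) - [:poly f 1:] \<bullet> (norm \<bullet> x) \<in> P"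
  by (rule act_fixed[OF norm_fixed])

lemma P_subset_fixed: "P \<subseteq> fixed" by (auto simp only: fixed_def mem_Collect_eq P_act)

lemma subspace_congD: "subspace M \<Longrightarrow> P \<subseteq> M \<Longrightarrow> x - y \<in> P \<Longrightarrow> y \<in> M \<Longrightarrow> x \<in> M"
  by (metis diff_add_cancel subspace_add subsetD)

lemma subspace_congD': "subspace M \<Longrightarrow> P \<subseteq> M \<Longrightarrow> x - y \<in> P \<Longrightarrow> x \<in> M \<Longrightarrow> y \<in> M"
  by (metis minus_diff_eq P_neg subspace_congD)

lemma P_trans: "x - y \<in> P \<Longrightarrow> y - z \<in> P \<Longrightarrow> x - z \<in> P"
  using P_add[of "x - y" "y - z"] by simp

lemma norms_subset_fixed: "norms \<subseteq> fixed"
  unfolding norms_def using subspace_congD[OF subspace_fixed P_subset_fixed _ norm_fixed] by blast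

lemma subspace_norms: "subspace norms"
proof (rule subspaceI)
  show "0 \<in> norms" unfolding norms_def using P_0 by (auto intro!: exI[of _ 0])
next
  fix x y assume "x \<in> norms" "y \<in> norms"
  then obtain u v where "x - norm \<bullet> u \<in> P" "y - norm \<bullet> v \<in> P" unfolding norms_def by blast
  hence "(x - norm \<bullet> u) + (y - norm \<bullet> v) \<in> P" by (rule P_add)
  hence "x + y - norm \<bullet> (u + v) \<in> P" by (simp only: scale_right_distrib add_diff_add)
  thus "x + y \<in> norms" unfolding norms_def by blast
next
  fix f x assume "x \<in> norms"
  then obtain u where "x - norm \<bullet> u \<in> P" unfolding norms_def by blast
  hence "f \<bullet> (x - norm \<bullet> u) \<in> P" by (rule P_act)
  hence "f \<bullet> x - norm \<bullet> (f \<bullet> u) \<in> P" by (simp only: scale_right_diff_distrib scale_left_commute)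
  thus "f \<bullet> x \<in> norms" unfolding norms_def by blast
qed

lemma norm_in_norms: "norm \<bullet> x \<in> norms"
  unfolding norms_def using P_0 by (intro CollectI exI[of _ x]) simp

lemma P_subset_norms: "P \<subseteq> norms"
  unfolding norms_def by (auto intro!: exI[of _ 0])

section \<open>Independence and span over F_p, modulo \<open>P\<close>\<close>

definition fp_indep :: "('b \<Rightarrow> 'a) \<Rightarrow> 'b set \<Rightarrow> bool" where
  "fp_indep g B \<longleftrightarrow> (\<forall>S k. finite S \<and> S \<subseteq> B \<and> (\<Sum>b\<in>S. [:k b:] \<bullet> g b) \<in> P \<longrightarrow> (\<forall>b\<in>S. int p dvd k b))"

text \<open>Like \<open>fp_indep\<close>, this concerns a family \<open>g\<close> on an index set
  rather than a set of vectors, so that one theory serves for the identity, the norm map and the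
  passage from field elements to module elements. Scalars are integers, read modulo
  \<open>p\<close>.\<close>

definition fp_span :: "('b \<Rightarrow> 'a) \<Rightarrow> 'b set \<Rightarrow> 'a set" where
  "fp_span g B = {x. \<exists>S k. finite S \<and> S \<subseteq> B \<and> x - (\<Sum>b\<in>S. [:k b:] \<bullet> g b) \<in> P}"

lemma fp_indepD: "fp_indep g B \<Longrightarrow> finite S \<Longrightarrow> S \<subseteq> B \<Longrightarrow> (\<Sum>b\<in>S. [:k b:] \<bullet> g b) \<in> P \<Longrightarrow> b \<in> S \<Longrightarrow>
    int p dvd k b"
  unfolding fp_indep_def by blast

lemma multiple_in_fp_span:
  assumes "[:k:] \<bullet> g w + (\<Sum>b\<in>S. [:l b:] \<bullet> g b) \<in> P" "\<not> int p dvd k" "finite S" "S \<subseteq> B"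
  shows "g w \<in> fp_span g B"
proof -
  obtain m where m: "int p dvd m * k - 1"
    using coprime_prime_int[OF prime_p assms(2)] by blast
  have "[:m:] \<bullet> ([:k:] \<bullet> g w + (\<Sum>b\<in>S. [:l b:] \<bullet> g b)) \<in> P"
    using assms(1) by (rule P_act)
  hence "[:m * k:] \<bullet> g w + (\<Sum>b\<in>S. [:m * l b:] \<bullet> g b) \<in> P"
    by (simp add: scale_right_distrib scale_sum_right mult.commute)
  moreover have "[:m * k - 1:] \<bullet> g w \<in> P" using m by (rule multiple_act)
  moreover have "[:m * k - 1:] \<bullet> g w = [:m * k:] \<bullet> g w - g w"
    by (metis (no_types) diff_pCons diff_zero one_pCons scale_left_diff_distrib scale_one)
  ultimately have "([:m * k:] \<bullet> g w + (\<Sum>b\<in>S. [:m * l b:] \<bullet> g b)) - ([:m * k:] \<bullet> g w - g w) \<in> P"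
    using P_diff by metis
  hence "g w + (\<Sum>b\<in>S. [:m * l b:] \<bullet> g b) \<in> P" by (simp add: add.commute)
  moreover have "(\<Sum>b\<in>S. [:- (m * l b):] \<bullet> g b) = - (\<Sum>b\<in>S. [:m * l b:] \<bullet> g b)"
    by (metis (no_types, lifting) minus_pCons minus_zero scale_minus_left sum.cong sum_negf)
  ultimately have "g w - (\<Sum>b\<in>S. [:- (m * l b):] \<bullet> g b) \<in> P" by simp
  thus ?thesis unfolding fp_span_def
    by (intro CollectI exI[of _ S] exI[of _ "\<lambda>b. - (m * l b)"] conjI assms)
qed

lemma fp_indep_insert:
  assumes "fp_indep g B" "g w \<notin> fp_span g B"
  shows "fp_indep g (insert w B)"
  unfolding fp_indep_def
proof (intro allI impI ballI, elim conjE)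
  fix S k b
  assume S: "finite S" "S \<subseteq> insert w B" "(\<Sum>b\<in>S. [:k b:] \<bullet> g b) \<in> P" "b \<in> S"
  show "int p dvd k b"
  proof (cases "w \<in> S")
    case False
    thus ?thesis using fp_indepD[OF assms(1) S(1) _ S(3,4)] S(2) by blast
  next
    case True
    have eq: "(\<Sum>b\<in>S. [:k b:] \<bullet> g b) = [:k w:] \<bullet> g w + (\<Sum>b\<in>S - {w}. [:k b:] \<bullet> g b)"
      using S(1) True by (rule sum.remove)
    have w: "int p dvd k w"
      using multiple_in_fp_span[of "k w" g w k "S - {w}" B] S assms(2) unfolding eq by blast
    hence "(\<Sum>b\<in>S - {w}. [:k b:] \<bullet> g b) \<in> P"
      using P_diff[OF S(3) multiple_act[OF w, of "g w"]] unfolding eq by simp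
    thus ?thesis
      using fp_indepD[OF assms(1), of "S - {w}" k b] S w by (cases "b = w") auto
  qed
qed

lemma maximal_fp_indep_exists:
  "\<exists>B. fp_indep g B \<and> (\<forall>A. fp_indep g A \<and> B \<subseteq> A \<longrightarrow> A = B)"
  by (rule maximal_set_finite_char) (unfold fp_indep_def, blast+)

lemma in_fp_span: "b \<in> B \<Longrightarrow> g b \<in> fp_span g B"
  unfolding fp_span_def using P_0
  by (intro CollectI exI[of _ "{b}"] exI[of _ "\<lambda>_. 1"]) (auto simp: one_pCons[symmetric])

lemma maximal_fp_indep_span:
  assumes "fp_indep g B" "\<And>A. fp_indep g A \<Longrightarrow> B \<subseteq> A \<Longrightarrow> A = B"
  shows "g w \<in> fp_span g B"
proof (rule ccontr)
  assume "g w \<notin> fp_span g B"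
  with fp_indep_insert[OF assms(1) this] assms(2) in_fp_span[of w B g] show False by blast
qed

lemma fp_span_subset:
  assumes "subspace M" "P \<subseteq> M" "\<And>b. b \<in> B \<Longrightarrow> g b \<in> M"
  shows "fp_span g B \<subseteq> M"
proof
  fix x assume "x \<in> fp_span g B"
  then obtain S k where "S \<subseteq> B" "x - (\<Sum>b\<in>S. [:k b:] \<bullet> g b) \<in> P"
    unfolding fp_span_def by blast
  moreover have "(\<Sum>b\<in>S. [:k b:] \<bullet> g b) \<in> M"
    using \<open>S \<subseteq> B\<close> assms by (intro subspace_sum subspace_scale) auto
  ultimately show "x \<in> M" using subspace_congD[OF assms(1,2)] by blast
qed

lemma subspace_span_P: "subspace (span (B \<union> P))" "P \<subseteq> span (B \<union> P)" "B \<subseteq> span (B \<union> P)"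
  using span_superset[of "B \<union> P"] by auto

lemma span_P_minimal: "subspace M \<Longrightarrow> P \<subseteq> M \<Longrightarrow> B \<subseteq> M \<Longrightarrow> span (B \<union> P) \<subseteq> M"
  by (simp add: span_minimal)

lemma span_P_explicit:
  assumes "x \<in> span (B \<union> P)"
  shows "\<exists>S f. finite S \<and> S \<subseteq> B \<and> x - (\<Sum>b\<in>S. f b \<bullet> b) \<in> P"
proof -
  have "span P = P" using subspace_P by (simp add: span_eq_iff)
  with assms obtain y z where "x = y + z" "y \<in> span B" "z \<in> P"
    unfolding span_Un by auto
  moreover obtain S f where "finite S" "S \<subseteq> B" "y = (\<Sum>b\<in>S. f b \<bullet> b)"
    using \<open>y \<in> span B\<close> unfolding span_explicit by blast
  ultimately show ?thesis by (intro exI[of _ S] exI[of _ f]) auto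
qed

text \<open>On fixed elements each coefficient \<open>f b\<close> may be replaced by its
  augmentation, so generating a submodule adds nothing to the F_p-span.\<close>

lemma span_P_fixed:
  assumes "B \<subseteq> fixed"
  shows "span (B \<union> P) = fp_span (\<lambda>b. b) B"
proof
  show "fp_span (\<lambda>b. b) B \<subseteq> span (B \<union> P)"
    using subspace_span_P[of B] by (intro fp_span_subset) auto
  show "span (B \<union> P) \<subseteq> fp_span (\<lambda>b. b) B"
  proof
    fix x assume "x \<in> span (B \<union> P)"
    from span_P_explicit[OF this]
    obtain S f where S: "finite S" "S \<subseteq> B" "x - (\<Sum>b\<in>S. f b \<bullet> b) \<in> P"
      by (elim exE conjE)
    have "(\<Sum>b\<in>S. f b \<bullet> b - [:poly (f b) 1:] \<bullet> b) \<in> P"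
      using S(2) assms by (intro P_sum act_fixed) auto
    hence "x - (\<Sum>b\<in>S. [:poly (f b) 1:] \<bullet> b) \<in> P"
      using P_trans[OF S(3)] by (simp only: sum_subtractf)
    thus "x \<in> fp_span (\<lambda>b. b) B" unfolding fp_span_def using S(1,2)
      by (intro CollectI exI[of _ S] exI[of _ "\<lambda>b. poly (f b) 1"]) blast
  qed
qed

lemma norms_eq_fp_span:
  assumes "\<And>w. norm \<bullet> w \<in> fp_span (\<lambda>b. norm \<bullet> b) B"
  shows "norms = fp_span (\<lambda>b. norm \<bullet> b) B"
proof
  show "fp_span (\<lambda>b. norm \<bullet> b) B \<subseteq> norms"
    by (intro fp_span_subset subspace_norms P_subset_norms norm_in_norms)
  show "norms \<subseteq> fp_span (\<lambda>b. norm \<bullet> b) B"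
  proof
    fix x assume "x \<in> norms"
    then obtain y where y: "x - norm \<bullet> y \<in> P" unfolding norms_def by blast
    obtain S k where "finite S" "S \<subseteq> B" "norm \<bullet> y - (\<Sum>b\<in>S. [:k b:] \<bullet> (norm \<bullet> b)) \<in> P"
      using assms[of y] unfolding fp_span_def by blast
    with P_trans[OF y] show "x \<in> fp_span (\<lambda>b. norm \<bullet> b) B" unfolding fp_span_def by blast
  qed
qed

text \<open>Scalars pass through the norm, so a combination of norms of elements of \<open>B\<close>
  is the norm of one element of the module generated by \<open>B\<close>. Chains are later shortened
  by subtracting images of such elements.\<close>

lemma norms_span:
  assumes "\<And>w. norm \<bullet> w \<in> fp_span (\<lambda>b. norm \<bullet> b) B" "x \<in> norms"
  shows "\<exists>y \<in> span (B \<union> P). x - norm \<bullet> y \<in> P"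
proof -
  obtain S k where S: "finite S" "S \<subseteq> B" "x - (\<Sum>b\<in>S. [:k b:] \<bullet> (norm \<bullet> b)) \<in> P"
    using assms unfolding norms_eq_fp_span[OF assms(1)] unfolding fp_span_def by blast
  have "(\<Sum>b\<in>S. [:k b:] \<bullet> (norm \<bullet> b)) = norm \<bullet> (\<Sum>b\<in>S. [:k b:] \<bullet> b)"
    by (simp only: scale_sum_right scale_left_commute)
  moreover have "(\<Sum>b\<in>S. [:k b:] \<bullet> b) \<in> span (B \<union> P)"
    using S(2) subspace_span_P[of B] by (intro subspace_sum subspace_scale) auto
  ultimately show ?thesis using S(3) by metis
qed

text \<open>If a relation has all coefficients divisible by \<open>t\<^sup>j\<close>, multiplying it by \<open>t\<^sup>p\<^sup>-\<^sup>1\<^sup>-\<^sup>j\<close> gives a relation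
  between the norms, whence all coefficients are divisible by \<open>t\<^sup>j\<^sup>+\<^sup>1\<close>.\<close>

lemma norm_indep_imp_free:
  assumes indep: "fp_indep (\<lambda>b. norm \<bullet> b) B"
    and S: "finite S" "S \<subseteq> B" "(\<Sum>b\<in>S. f b \<bullet> b) \<in> P"
  shows "\<forall>b\<in>S. f b \<in> relation_ideal p"
proof -
  have "j \<le> p \<Longrightarrow> \<exists>g. \<forall>b\<in>S. f b - t ^ j * g b \<in> relation_ideal p" for j
  proof (induction j)
    case 0
    show ?case using const_in_relation_ideal[of p 0] by (intro exI[of _ f]) simp
  next
    case (Suc j)
    then obtain g where g: "\<And>b. b \<in> S \<Longrightarrow> f b - t ^ j * g b \<in> relation_ideal p" by auto
    have pj: "t ^ (p - 1 - j) * t ^ j = t ^ (p - 1)"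
      using Suc.prems by (simp only: power_add[symmetric]) simp
    have "t ^ (p - 1 - j) \<bullet> (f b \<bullet> b) - [:poly (g b) 1:] \<bullet> (norm \<bullet> b) \<in> P" if "b \<in> S" for b
    proof -
      have "t ^ (p - 1 - j) \<bullet> ((f b - t ^ j * g b) \<bullet> b) \<in> P"
        using g[OF that] by (intro P_act relation_ideal_act)
      hence "t ^ (p - 1 - j) \<bullet> (f b \<bullet> b) - t ^ (p - 1) \<bullet> (g b \<bullet> b) \<in> P"
        by (simp only: scale_left_diff_distrib scale_right_diff_distrib scale_scale
            mult.assoc[symmetric] pj)
      from P_trans[OF this t_power_norm] have
        "t ^ (p - 1 - j) \<bullet> (f b \<bullet> b) - g b \<bullet> (norm \<bullet> b) \<in> P" by (simp only: scale_left_commute)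
      from P_trans[OF this act_norm] show ?thesis .
    qed
    hence "(\<Sum>b\<in>S. t ^ (p - 1 - j) \<bullet> (f b \<bullet> b) - [:poly (g b) 1:] \<bullet> (norm \<bullet> b)) \<in> P"
      by (rule P_sum)
    hence "t ^ (p - 1 - j) \<bullet> (\<Sum>b\<in>S. f b \<bullet> b) - (\<Sum>b\<in>S. [:poly (g b) 1:] \<bullet> (norm \<bullet> b)) \<in> P"
      by (simp only: sum_subtractf scale_sum_right)
    from subspace_congD'[OF subspace_P order_refl this P_act[OF S(3)]]
    have "(\<Sum>b\<in>S. [:poly (g b) 1:] \<bullet> (norm \<bullet> b)) \<in> P" .
    from fp_indepD[OF indep S(1,2) this]
    have dvd: "int p dvd poly (g b) 1" if "b \<in> S" for b using that by blast
    have "\<forall>b. \<exists>g'. g b = [:poly (g b) 1:] + t * g'" using poly_split_at_1 by blast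
    then obtain g' where g': "\<And>b. g b = [:poly (g b) 1:] + t * g' b" by metis
    have "f b - t ^ Suc j * g' b \<in> relation_ideal p" if "b \<in> S" for b
    proof -
      have "t ^ j * g b = t ^ j * [:poly (g b) 1:] + t ^ Suc j * g' b"
        by (subst g') (simp only: distrib_left power_Suc2 mult.assoc)
      hence "f b - t ^ Suc j * g' b = (f b - t ^ j * g b) + t ^ j * [:poly (g b) 1:]"
        by (simp only: diff_add_eq diff_diff_eq2 add_diff_cancel_right add.commute)
      thus ?thesis
        using g[OF that] const_in_relation_ideal[OF dvd[OF that]]
        by (simp only: relation_ideal_add relation_ideal_mult)
    qed
    thus ?case by blast
  qed
  from this[of p] obtain g where g: "\<And>b. b \<in> S \<Longrightarrow> f b - t ^ p * g b \<in> relation_ideal p" by auto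
  obtain h where "t ^ p = (monom 1 p - 1) + [:int p:] * h"
    using X_minus_1_power_prime[OF prime_p odd_p] by blast
  hence "t ^ p = (monom 1 p - 1) * 1 + [:int p:] * h" by (simp only: mult_1_right)
  hence tp: "t ^ p \<in> relation_ideal p" unfolding relation_ideal_def by blast
  show ?thesis
  proof
    fix b assume "b \<in> S"
    from relation_ideal_add[OF g[OF this] relation_ideal_mult[OF tp, of "g b"]]
    show "f b \<in> relation_ideal p" by (simp only: mult.commute[of "g b"] diff_add_cancel)
  qed
qed

text \<open>In F_p[G] only multiples of the norm element are killed by \<open>t\<close>:
  \<open>X ^ p - 1\<close> is \<open>t\<close> times the norm polynomial, and \<open>t\<close> can
  be cancelled modulo \<open>p\<close>. Freeness transfers this to each coefficient of a fixed
  element.\<close>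

lemma span_Int_fixed_subset_norms:
  assumes indep: "fp_indep (\<lambda>b. norm \<bullet> b) B"
  shows "span (B \<union> P) \<inter> fixed \<subseteq> norms"
proof
  fix x assume x: "x \<in> span (B \<union> P) \<inter> fixed"
  from span_P_explicit[OF IntD1[OF this]]
  obtain S f where S: "finite S" "S \<subseteq> B" "x - (\<Sum>b\<in>S. f b \<bullet> b) \<in> P"
    by (elim exE conjE)
  have "t \<bullet> x \<in> P" using x by (simp add: fixed_def)
  moreover have "t \<bullet> x - (\<Sum>b\<in>S. (t * f b) \<bullet> b) \<in> P"
    using P_act[OF S(3), of t] by (simp only: scale_right_diff_distrib scale_sum_right scale_scale)
  ultimately have "(\<Sum>b\<in>S. (t * f b) \<bullet> b) \<in> P" using P_diff by fastforce
  from norm_indep_imp_free[OF indep S(1,2) this]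
  have tf: "t * f b \<in> relation_ideal p" if "b \<in> S" for b using that by blast
  have "f b \<bullet> b \<in> norms" if bS: "b \<in> S" for b
  proof -
    obtain g h where "t * f b = (monom 1 p - 1) * g + [:int p:] * h"
      using tf[OF bS] unfolding relation_ideal_def by blast
    hence "t * f b = t * (norm * g) + [:int p:] * h"
      by (simp only: X_minus_1_times_norm_poly[symmetric] mult.assoc)
    then obtain h' where "f b = norm * g + [:int p:] * h'"
      using cancel_X_minus_1_mod[OF prime_p] by blast
    hence "f b \<bullet> b - norm \<bullet> (g \<bullet> b) = [:int p:] \<bullet> (h' \<bullet> b)"
      by (simp only: scale_left_distrib scale_scale) simp
    hence "f b \<bullet> b - norm \<bullet> (g \<bullet> b) \<in> P" by (simp only: p_act)
    thus ?thesis unfolding norms_def by blast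
  qed
  hence "(\<Sum>b\<in>S. f b \<bullet> b) \<in> norms" by (intro subspace_sum subspace_norms)
  thus "x \<in> norms" using subspace_congD[OF subspace_norms P_subset_norms S(3)] by blast
qed

lemma fixed_complement:
  assumes U: "subspace U" "P \<subseteq> U"
  shows "\<exists>Z. subspace Z \<and> P \<subseteq> Z \<and> Z \<subseteq> fixed \<and> Z \<inter> U = P \<and> fixed \<subseteq> span (Z \<union> U)"
proof -
  \<comment> \<open>The locale is instantiated again with \<open>U\<close> in place of
    \<open>P\<close>; independence modulo \<open>U\<close> and the existence of maximal families
    then come for free.\<close>
  have "group_ring_module act p U"
    by (intro group_ring_module.intro group_ring_module_axioms.intro module_axioms
        prime_p odd_p U(1) subsetD[OF U(2) p_act] subsetD[OF U(2) cyclic_act])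
  then interpret U: group_ring_module act p U .
  \<comment> \<open>Sending non-fixed elements to 0 keeps them out of every independent set, so the
    maximal family consists of fixed elements although the Zorn argument ranges over all
    subsets.\<close>
  define g where "g = (\<lambda>w. if w \<in> fixed then w else 0)"
  obtain B where B: "U.fp_indep g B" "\<And>A. U.fp_indep g A \<Longrightarrow> B \<subseteq> A \<Longrightarrow> A = B"
    using U.maximal_fp_indep_exists[of g] by blast
  have "b \<in> fixed" if "b \<in> B" for b
  proof (rule ccontr)
    assume "b \<notin> fixed"
    hence "(\<Sum>b\<in>{b}. [:1:] \<bullet> g b) \<in> U" using U.P_0 by (simp add: g_def)
    from U.fp_indepD[OF B(1) _ _ this, of b] that prime_p show False by auto
  qed
  hence Bf: "B \<subseteq> fixed" by blast
  have gB: "g b = b" if "b \<in> B" for b using that Bf by (auto simp: g_def)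
  define Z where "Z = span (B \<union> P)"
  have "Z \<inter> U \<subseteq> P"
  proof
    fix x assume x: "x \<in> Z \<inter> U"
    then obtain S k where S: "finite S" "S \<subseteq> B" "x - (\<Sum>b\<in>S. [:k b:] \<bullet> b) \<in> P"
      unfolding Z_def span_P_fixed[OF Bf] fp_span_def by blast
    have "(\<Sum>b\<in>S. [:k b:] \<bullet> b) \<in> U"
      using subspace_congD'[OF U S(3)] x by blast
    moreover have "(\<Sum>b\<in>S. [:k b:] \<bullet> b) = (\<Sum>b\<in>S. [:k b:] \<bullet> g b)"
      by (rule sum.cong) (use S(2) gB in auto)
    ultimately have "int p dvd k b" if "b \<in> S" for b
      using U.fp_indepD[OF B(1) S(1,2) _ that] by simp
    hence "(\<Sum>b\<in>S. [:k b:] \<bullet> b) \<in> P" by (intro P_sum multiple_act)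
    thus "x \<in> P" using subspace_congD[OF subspace_P _ S(3)] by blast
  qed
  moreover have "fixed \<subseteq> span (Z \<union> U)"
  proof
    fix w assume "w \<in> fixed"
    hence "w \<in> U.fp_span g B"
      using U.maximal_fp_indep_span[OF B, of w] by (simp add: g_def)
    moreover have "U.fp_span g B \<subseteq> span (Z \<union> U)"
      using subspace_span_P(3)[of B] span_superset[of "Z \<union> U"] gB unfolding Z_def
      by (intro U.fp_span_subset) auto
    ultimately show "w \<in> span (Z \<union> U)" by blast
  qed
  moreover have "P \<subseteq> Z" "subspace Z" unfolding Z_def by (rule subspace_span_P)+
  moreover have "Z \<subseteq> fixed" unfolding Z_def
    by (intro span_P_minimal subspace_fixed P_subset_fixed Bf)
  ultimately show ?thesis using U(2) by (intro exI[of _ Z]) blast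
qed

lemma invert_scalar:
  assumes "subspace M" "P \<subseteq> M" "[:k:] \<bullet> v \<in> M" "\<not> int p dvd k"
  shows "v \<in> M"
proof -
  obtain m where m: "int p dvd m * k - 1"
    using coprime_prime_int[OF prime_p assms(4)] by blast
  have "[:m * k - 1:] = [:m:] * [:k:] - 1" by (simp add: one_pCons)
  hence "[:m * k - 1:] \<bullet> v = [:m:] \<bullet> ([:k:] \<bullet> v) - v"
    by (simp only: scale_left_diff_distrib scale_scale scale_one)
  hence "[:m:] \<bullet> ([:k:] \<bullet> v) - v \<in> P" using multiple_act[OF m, of v] by simp
  thus ?thesis using subspace_congD'[OF assms(1,2)] subspace_scale[OF assms(1,3)] by blast
qed

text \<open>A nonzero element of the line is \<open>k\<close> times \<open>v\<close> with
  \<open>k\<close> invertible modulo \<open>p\<close>. This provides the hypothesis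
  \<open>simple\<close> of the decomposition for X of dimension 1.\<close>

lemma line_simple:
  assumes "v \<in> fixed" "subspace M" "P \<subseteq> M" "M \<subseteq> span ({v} \<union> P)" "M \<noteq> P"
  shows "v \<in> M"
proof -
  obtain x where x: "x \<in> M" "x \<notin> P" using assms(3,5) by blast
  hence "x \<in> fp_span (\<lambda>b. b) {v}" using assms(1,4) span_P_fixed[of "{v}"] by auto
  then obtain S k where S: "S \<subseteq> {v}" "x - (\<Sum>b\<in>S. [:k b:] \<bullet> b) \<in> P" unfolding fp_span_def by blast
  have "S = {v}" using S x(2) by (cases "S = {}") auto
  hence k: "x - [:k v:] \<bullet> v \<in> P" using S by simp
  hence "\<not> int p dvd k v" using x(2) subspace_congD[OF subspace_P order_refl k multiple_act]
    by blast
  thus ?thesis using invert_scalar[OF assms(2,3)] subspace_congD'[OF assms(2,3) k x(1)] by blast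
qed

lemma line_indep:
  assumes "v \<notin> P"
  shows "fp_indep (\<lambda>b. b) {v}"
  unfolding fp_indep_def
proof (intro allI impI ballI, elim conjE)
  fix S k b assume S: "S \<subseteq> {v}" "(\<Sum>b\<in>S. [:k b:] \<bullet> b) \<in> P" "b \<in> S"
  hence "S = {v}" "b = v" by auto
  thus "int p dvd k b" using S(2) invert_scalar[OF subspace_P order_refl, of "k v" v] assms by auto
qed

section \<open>The two-dimensional module spanned by \<open>a\<close> and
  \<open>e = t a\<close>\<close>

context
  fixes a e assumes e: "t \<bullet> a - e \<in> P" "e \<in> fixed" "e \<notin> P"
begin

lemma pair_distinct: "a \<noteq> e"
proof
  assume "a = e"
  hence "t \<bullet> a \<in> P" using e(2) by (simp only: fixed_def mem_Collect_eq)
  thus False using subspace_congD'[OF subspace_P order_refl e(1)] e(3) by blast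
qed

text \<open>Modulo \<open>P\<close>, \<open>t\<close> sends \<open>a\<close> to \<open>e\<close> and
  \<open>e\<close> to 0. So from \<open>f = f(1) + t * g\<close> one gets \<open>f(1)\<close> and
  \<open>g(1)\<close> as the coefficients of \<open>f \<bullet> a\<close>, and \<open>f\<close> acts
  on \<open>e\<close> by \<open>f(1)\<close>.\<close>

lemma pair_act: "\<exists>i j. f \<bullet> ([:k:] \<bullet> a + [:l:] \<bullet> e) - ([:i:] \<bullet> a + [:j:] \<bullet> e) \<in> P"
proof -
  have fa: "\<exists>i j. f \<bullet> a - ([:i:] \<bullet> a + [:j:] \<bullet> e) \<in> P" for f
  proof -
    obtain g where "f = [:poly f 1:] + t * g" using poly_split_at_1 by blast
    hence "f \<bullet> a = ([:poly f 1:] + g * t) \<bullet> a" by (metis mult.commute)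
    hence "f \<bullet> a - ([:poly f 1:] \<bullet> a + [:poly g 1:] \<bullet> e)
        = g \<bullet> (t \<bullet> a - e) + (g \<bullet> e - [:poly g 1:] \<bullet> e)"
      by (simp only: scale_left_distrib scale_right_diff_distrib scale_scale) simp
    hence "f \<bullet> a - ([:poly f 1:] \<bullet> a + [:poly g 1:] \<bullet> e) \<in> P"
      using P_add[OF P_act[OF e(1)] act_fixed[OF e(2)]] by (simp only:)
    thus ?thesis by blast
  qed
  obtain i j where ij: "(f * [:k:]) \<bullet> a - ([:i:] \<bullet> a + [:j:] \<bullet> e) \<in> P" using fa by blast
  have fe: "(f * [:l:]) \<bullet> e - [:poly (f * [:l:]) 1:] \<bullet> e \<in> P" by (rule act_fixed[OF e(2)])
  have "[:j + poly (f * [:l:]) 1:] = [:j:] + [:poly (f * [:l:]) 1:]" by simp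
  hence "f \<bullet> ([:k:] \<bullet> a + [:l:] \<bullet> e) - ([:i:] \<bullet> a + [:j + poly (f * [:l:]) 1:] \<bullet> e)
     = ((f * [:k:]) \<bullet> a - ([:i:] \<bullet> a + [:j:] \<bullet> e)) + ((f * [:l:]) \<bullet> e - [:poly (f * [:l:]) 1:] \<bullet> e)"
    by (simp only: scale_right_distrib scale_left_distrib scale_scale) (simp add: algebra_simps)
  hence "f \<bullet> ([:k:] \<bullet> a + [:l:] \<bullet> e) - ([:i:] \<bullet> a + [:j + poly (f * [:l:]) 1:] \<bullet> e) \<in> P"
    using P_add[OF ij fe] by (simp only:)
  thus ?thesis by blast
qed

lemma span_pair_explicit:
  assumes "x \<in> span ({a, e} \<union> P)"
  shows "\<exists>i j. x - ([:i:] \<bullet> a + [:j:] \<bullet> e) \<in> P"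
proof -
  let ?R = "{x. \<exists>i j. x - ([:i:] \<bullet> a + [:j:] \<bullet> e) \<in> P}"
  have "subspace ?R"
  proof (rule subspaceI)
    show "0 \<in> ?R" using P_0 by (intro CollectI exI[of _ 0]) simp
  next
    fix x y assume "x \<in> ?R" "y \<in> ?R"
    then obtain i j k l where "x - ([:i:] \<bullet> a + [:j:] \<bullet> e) \<in> P" "y - ([:k:] \<bullet> a + [:l:] \<bullet> e) \<in> P"
      by blast
    note sum = P_add[OF this]
    have "x + y - (([:i:] + [:k:]) \<bullet> a + ([:j:] + [:l:]) \<bullet> e)
        = (x - ([:i:] \<bullet> a + [:j:] \<bullet> e)) + (y - ([:k:] \<bullet> a + [:l:] \<bullet> e))"
      by (simp only: scale_left_distrib) (simp add: algebra_simps)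
    with sum have "x + y - (([:i:] + [:k:]) \<bullet> a + ([:j:] + [:l:]) \<bullet> e) \<in> P" by (simp only:)
    moreover have "[:i:] + [:k:] = [:i + k:]" "[:j:] + [:l:] = [:j + l:]" by simp_all
    ultimately show "x + y \<in> ?R" by (simp only: mem_Collect_eq) blast
  next
    fix f x assume "x \<in> ?R"
    then obtain k l where kl: "x - ([:k:] \<bullet> a + [:l:] \<bullet> e) \<in> P" by blast
    obtain i j where ij: "f \<bullet> ([:k:] \<bullet> a + [:l:] \<bullet> e) - ([:i:] \<bullet> a + [:j:] \<bullet> e) \<in> P"
      using pair_act by blast
    have "f \<bullet> x - f \<bullet> ([:k:] \<bullet> a + [:l:] \<bullet> e) \<in> P"
      using P_act[OF kl, of f] by (simp only: scale_right_diff_distrib)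
    from P_trans[OF this ij] show "f \<bullet> x \<in> ?R" by blast
  qed
  moreover have "P \<subseteq> ?R"
  proof
    fix x assume "x \<in> P"
    hence "x - ([:0:] \<bullet> a + [:0:] \<bullet> e) \<in> P" by simp
    thus "x \<in> ?R" by blast
  qed
  moreover have "a - ([:1:] \<bullet> a + [:0:] \<bullet> e) \<in> P" "e - ([:0:] \<bullet> a + [:1:] \<bullet> e) \<in> P"
    using P_0 by (simp_all add: one_pCons[symmetric])
  hence "{a, e} \<subseteq> ?R" by blast
  ultimately show ?thesis using span_P_minimal[of ?R "{a, e}"] assms by blast
qed

lemma span_pair: "span ({a, e} \<union> P) = fp_span (\<lambda>b. b) {a, e}"
proof
  show "fp_span (\<lambda>b. b) {a, e} \<subseteq> span ({a, e} \<union> P)"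
    using subspace_span_P[of "{a, e}"] by (intro fp_span_subset) auto
  show "span ({a, e} \<union> P) \<subseteq> fp_span (\<lambda>b. b) {a, e}"
  proof
    fix x assume "x \<in> span ({a, e} \<union> P)"
    then obtain i j where "x - ([:i:] \<bullet> a + [:j:] \<bullet> e) \<in> P" using span_pair_explicit by blast
    hence "x - (\<Sum>b\<in>{a, e}. [:(if b = a then i else j):] \<bullet> b) \<in> P" using pair_distinct by simp
    thus "x \<in> fp_span (\<lambda>b. b) {a, e}" unfolding fp_span_def
      by (intro CollectI exI[of _ "{a, e}"] exI[of _ "\<lambda>b. if b = a then i else j"]) simp
  qed
qed

lemma t_pair:
  assumes "x - ([:i:] \<bullet> a + [:j:] \<bullet> e) \<in> P"
  shows "t \<bullet> x - [:i:] \<bullet> e \<in> P"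
proof -
  have "t \<bullet> (x - ([:i:] \<bullet> a + [:j:] \<bullet> e)) \<in> P" using assms by (rule P_act)
  hence 1: "t \<bullet> x - ([:i:] \<bullet> (t \<bullet> a) + [:j:] \<bullet> (t \<bullet> e)) \<in> P"
    by (simp only: scale_right_diff_distrib scale_right_distrib scale_left_commute[of t])
  have "[:i:] \<bullet> (t \<bullet> a - e) \<in> P" using e(1) by (rule P_act)
  moreover have "[:j:] \<bullet> (t \<bullet> e) \<in> P" by (rule P_act[OF e(2)[unfolded fixed_def mem_Collect_eq]])
  ultimately have "[:i:] \<bullet> (t \<bullet> a - e) + [:j:] \<bullet> (t \<bullet> e) \<in> P" by (rule P_add)
  hence "([:i:] \<bullet> (t \<bullet> a) + [:j:] \<bullet> (t \<bullet> e)) - [:i:] \<bullet> e \<in> P"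
    by (simp only: scale_right_diff_distrib diff_add_eq)
  from P_trans[OF 1 this] show ?thesis .
qed

text \<open>If \<open>a\<close> occurs in \<open>x\<close> with a coefficient prime to
  \<open>p\<close>, then \<open>t \<bullet> x\<close> is an invertible multiple of \<open>e\<close>;
  otherwise \<open>x\<close> itself is one.\<close>

lemma pair_simple:
  assumes "subspace M" "P \<subseteq> M" "M \<subseteq> span ({a, e} \<union> P)" "M \<noteq> P"
  shows "e \<in> M"
proof -
  obtain x where x: "x \<in> M" "x \<notin> P" using assms(2,4) by blast
  then obtain i j where ij: "x - ([:i:] \<bullet> a + [:j:] \<bullet> e) \<in> P" using span_pair_explicit assms(3)
    by blast
  show ?thesis
  proof (cases "int p dvd i")
    case False
    have "[:i:] \<bullet> e \<in> M"
      using subspace_congD'[OF assms(1,2) t_pair[OF ij]] subspace_scale[OF assms(1) x(1)] by blast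
    thus ?thesis using invert_scalar[OF assms(1,2)] False by blast
  next
    case True
    from P_add[OF ij multiple_act[OF True, of a]]
    have j: "x - [:j:] \<bullet> e \<in> P" by (simp only: diff_diff_eq[symmetric]) (simp add: algebra_simps)
    hence "\<not> int p dvd j" using x(2) subspace_congD[OF subspace_P order_refl j multiple_act]
      by blast
    thus ?thesis using invert_scalar[OF assms(1,2)] subspace_congD'[OF assms(1,2) j x(1)] by blast
  qed
qed

text \<open>The span of \<open>e\<close> consists of fixed elements, whereas \<open>a\<close> is not
  fixed because \<open>t\<close> sends it to \<open>e\<close>.\<close>

lemma pair_indep: "fp_indep (\<lambda>b. b) {a, e}"
proof -
  have e_indep: "fp_indep (\<lambda>b. b) {e}" using e(3) by (rule line_indep)
  have "a \<notin> fp_span (\<lambda>b. b) {e}"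
  proof
    assume "a \<in> fp_span (\<lambda>b. b) {e}"
    hence "a \<in> fixed"
      using fp_span_subset[OF subspace_fixed P_subset_fixed, of "{e}" "\<lambda>b. b"] e(2) by blast
    hence "t \<bullet> a \<in> P" by (simp only: fixed_def mem_Collect_eq)
    thus False using subspace_congD'[OF subspace_P order_refl e(1)] e(3) by blast
  qed
  thus ?thesis using fp_indep_insert[OF e_indep] by blast
qed

end

text \<open>This and the next lemma reindex families: bases of J are sets of field elements, while
  independence is established for elements of the module.\<close>

lemma fp_indep_image:
  assumes "fp_indep (\<lambda>b. g (h b)) B" "inj_on h B"
  shows "fp_indep g (h ` B)"
  unfolding fp_indep_def
proof (intro allI impI ballI, elim conjE)
  fix S k b assume S: "finite S" "S \<subseteq> h ` B" "(\<Sum>b\<in>S. [:k b:] \<bullet> g b) \<in> P" "b \<in> S"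
  obtain T where T: "T \<subseteq> B" "S = h ` T" "finite T" using finite_subset_image[OF S(1,2)] by blast
  have "inj_on h T" using assms(2) T(1) by (rule inj_on_subset)
  hence "(\<Sum>b\<in>S. [:k b:] \<bullet> g b) = (\<Sum>b\<in>T. [:k (h b):] \<bullet> g (h b))"
    unfolding T(2) by (simp add: sum.reindex)
  thus "int p dvd k b"
    using S(3,4) T fp_indepD[OF assms(1) T(3,1), of "\<lambda>b. k (h b)"] by auto
qed

lemma fp_span_image:
  assumes "inj_on h B"
  shows "fp_span g (h ` B) = fp_span (\<lambda>b. g (h b)) B"
proof
  show "fp_span g (h ` B) \<subseteq> fp_span (\<lambda>b. g (h b)) B"
  proof
    fix x assume "x \<in> fp_span g (h ` B)"
    then obtain S k where S: "finite S" "S \<subseteq> h ` B" "x - (\<Sum>b\<in>S. [:k b:] \<bullet> g b) \<in> P"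
      unfolding fp_span_def by blast
    obtain T where T: "T \<subseteq> B" "S = h ` T" "finite T" using finite_subset_image[OF S(1,2)] by blast
    have "inj_on h T" using assms T(1) by (rule inj_on_subset)
    hence "x - (\<Sum>b\<in>T. [:k (h b):] \<bullet> g (h b)) \<in> P"
      using S(3) unfolding T(2) by (simp add: sum.reindex)
    thus "x \<in> fp_span (\<lambda>b. g (h b)) B" unfolding fp_span_def using T
      by (intro CollectI exI[of _ T] exI[of _ "\<lambda>b. k (h b)"]) blast
  qed
  show "fp_span (\<lambda>b. g (h b)) B \<subseteq> fp_span g (h ` B)"
  proof
    fix x assume "x \<in> fp_span (\<lambda>b. g (h b)) B"
    then obtain S k where S: "finite S" "S \<subseteq> B" "x - (\<Sum>b\<in>S. [:k b:] \<bullet> g (h b)) \<in> P"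
      unfolding fp_span_def by blast
    have inj: "inj_on h S" using assms S(2) by (rule inj_on_subset)
    have "(\<Sum>y\<in>h ` S. [:k (the_inv_into S h y):] \<bullet> g y) = (\<Sum>b\<in>S. [:k b:] \<bullet> g (h b))"
      using inj by (simp add: sum.reindex the_inv_into_f_f)
    hence "x - (\<Sum>y\<in>h ` S. [:k (the_inv_into S h y):] \<bullet> g y) \<in> P" using S(3) by simp
    thus "x \<in> fp_span g (h ` B)" unfolding fp_span_def using S(1,2)
      by (intro CollectI exI[of _ "h ` S"] exI[of _ "\<lambda>y. k (the_inv_into S h y)"]) blast
  qed
qed

text \<open>Since \<open>v\<close> lies in every nonzero submodule of X, directness reduces to
  \<open>v\<close> not being \<open>y + z\<close> with \<open>y\<close> in Y and \<open>z\<close> in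
  Z. Such a \<open>y\<close> would be fixed, hence a norm; then \<open>z\<close> would lie in
  \<open>Z \<inter> U = P\<close>, and \<open>v\<close> would be a norm. That the sum is everything
  depends on chains only through \<open>long\<close> and \<open>short\<close>.\<close>

lemma decomposition:
  assumes X: "subspace X" "P \<subseteq> X" "v \<in> X" "v \<in> fixed" "v \<notin> norms"
    and simple: "\<And>M. subspace M \<Longrightarrow> P \<subseteq> M \<Longrightarrow> M \<subseteq> X \<Longrightarrow> M \<noteq> P \<Longrightarrow> v \<in> M"
    and long: "\<And>x l. 3 \<le> l \<Longrightarrow> l \<le> p \<Longrightarrow> t ^ l \<bullet> x \<in> P \<Longrightarrow> t ^ (l - 1) \<bullet> x \<in> norms"
    and short: "\<And>x. t ^ 2 \<bullet> x \<in> P \<Longrightarrow> \<exists>w\<in>X. t \<bullet> x - t \<bullet> w \<in> norms"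
    and B: "fp_indep (\<lambda>b. norm \<bullet> b) B" "\<And>w. norm \<bullet> w \<in> fp_span (\<lambda>b. norm \<bullet> b) B"
  defines "Y \<equiv> span (B \<union> P)"
  shows "\<exists>Z. subspace Z \<and> P \<subseteq> Z \<and> Z \<subseteq> fixed \<and> Y \<inter> Z = P \<and> X \<inter> span (Y \<union> Z) = P
           \<and> span (X \<union> span (Y \<union> Z)) = UNIV"
proof -
  have Y: "subspace Y" "P \<subseteq> Y" unfolding Y_def by (rule subspace_span_P)+
  have Yfix: "Y \<inter> fixed \<subseteq> norms" unfolding Y_def by (rule span_Int_fixed_subset_norms[OF B(1)])
  define U where "U = span ({v} \<union> norms)"
  have "P \<subseteq> U" "norms \<subseteq> U" "v \<in> U" unfolding U_def
    using span_superset[of "{v} \<union> norms"] P_subset_norms by auto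
  then obtain Z where Z: "subspace Z" "P \<subseteq> Z" "Z \<subseteq> fixed" "Z \<inter> U = P" "fixed \<subseteq> span (Z \<union> U)"
    using fixed_complement[of U] unfolding U_def by blast
  have spanYZ: "span (Y \<union> Z) = {y + z |y z. y \<in> Y \<and> z \<in> Z}"
    using Y(1) Z(1) by (simp add: span_Un span_eq_iff[THEN iffD2])
  have "Y \<inter> Z \<subseteq> P" using Yfix Z(3,4) \<open>norms \<subseteq> U\<close> by blast
  hence YZ: "Y \<inter> Z = P" using Y(2) Z(2) by blast
  have XW: "X \<inter> span (Y \<union> Z) = P"
  proof (rule ccontr)
    assume "X \<inter> span (Y \<union> Z) \<noteq> P"
    moreover have "P \<subseteq> X \<inter> span (Y \<union> Z)" using X(2) Z(2) span_superset[of "Y \<union> Z"] by auto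
    moreover have "subspace (X \<inter> span (Y \<union> Z))" using X(1) by (intro subspace_inter) auto
    ultimately have "v \<in> X \<inter> span (Y \<union> Z)" using simple by blast
    then obtain y z where yz: "v = y + z" "y \<in> Y" "z \<in> Z" unfolding spanYZ by blast
    have "y = v - z" using yz(1) by simp
    hence "y \<in> fixed" using X(4) Z(3) yz(3) subspace_diff[OF subspace_fixed] by blast
    hence y: "y \<in> norms" using yz(2) Yfix by blast
    have "z = v - y" using yz(1) by simp
    moreover have "v - y \<in> U" using \<open>v \<in> U\<close> y \<open>norms \<subseteq> U\<close> subspace_diff[of U] unfolding U_def
      by blast
    ultimately have "z \<in> P" using yz(3) Z(4) by blast
    hence "v \<in> norms" using yz(1) y P_subset_norms subspace_add[OF subspace_norms] by blast
    thus False using X(5) by blast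
  qed
  define V where "V = span (X \<union> span (Y \<union> Z))"
  have V: "subspace V" "X \<subseteq> V" "Y \<subseteq> V" "Z \<subseteq> V" unfolding V_def
    using span_superset[of "X \<union> span (Y \<union> Z)"] span_superset[of "Y \<union> Z"] by auto
  have normsY: "\<exists>y\<in>Y. n - norm \<bullet> y \<in> P" if "n \<in> norms" for n
    unfolding Y_def by (rule norms_span[OF B(2) that])
  have normsV: "norms \<subseteq> V"
  proof
    fix n assume "n \<in> norms"
    then obtain y where y: "y \<in> Y" "n - norm \<bullet> y \<in> P" using normsY by blast
    have "norm \<bullet> y \<in> V" using y(1) V by (intro subspace_scale) auto
    thus "n \<in> V" using y(2) V X(2) subspace_congD[of V] by blast
  qed
  have fixedV: "fixed \<subseteq> V"
  proof -
    have "U \<subseteq> V" unfolding U_def using normsV X(3) V by (intro span_minimal) auto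
    hence "span (Z \<union> U) \<subseteq> V" using V by (intro span_minimal) auto
    thus ?thesis using Z(5) by blast
  qed
  \<comment> \<open>A chain is shortened by subtracting elements of X and Y whose images cancel its
    last element; chains of length 1 are the fixed elements, already known to lie in
    \<open>V\<close>.\<close>
  have "l \<le> p \<Longrightarrow> t ^ l \<bullet> x \<in> P \<Longrightarrow> x \<in> V" for l x
  proof (induction l arbitrary: x)
    case 0
    thus ?case using X(2) V(2) by auto
  next
    case (Suc l)
    consider "l = 0" | "l = 1" | "l \<ge> 2" by linarith
    thus ?case
    proof cases
      case 1
      thus ?thesis using Suc.prems(2) fixedV by (auto simp: fixed_def)
    next
      case 2
      then obtain w where w: "w \<in> X" "t \<bullet> x - t \<bullet> w \<in> norms"
        using short Suc.prems(2) by (auto simp: numeral_2_eq_2)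
      obtain y where y: "y \<in> Y" "t \<bullet> x - t \<bullet> w - norm \<bullet> y \<in> P" using normsY[OF w(2)] by blast
      \<comment> \<open>\<open>t ^ (p - 2) \<bullet> y\<close> is an element of Y that
        \<open>t\<close> sends to the norm of \<open>y\<close> modulo \<open>P\<close>; together
        with \<open>w\<close> it cancels \<open>t \<bullet> x\<close> and leaves a fixed
        element.\<close>
      have tt: "t ^ (p - 1) = t * t ^ (p - 2)"
        using Suc.prems(1) 2
          by (simp only: power_Suc[symmetric]) (simp add: Suc_diff_Suc numeral_2_eq_2)
      have "t \<bullet> x - t \<bullet> w - t ^ (p - 1) \<bullet> y \<in> P"
        using P_diff[OF y(2) t_power_norm[of y]] by simp
      hence "t \<bullet> (x - w - t ^ (p - 2) \<bullet> y) \<in> P"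
        by (simp only: tt scale_right_diff_distrib scale_scale)
      hence "x - w - t ^ (p - 2) \<bullet> y \<in> V" using Suc.IH[of "x - w - t ^ (p - 2) \<bullet> y"] Suc.prems(1) 2
        by simp
      moreover have "w + t ^ (p - 2) \<bullet> y \<in> V"
        using w(1) y(1) V by (intro subspace_add subspace_scale) auto
      ultimately have "(x - w - t ^ (p - 2) \<bullet> y) + (w + t ^ (p - 2) \<bullet> y) \<in> V"
        using V(1) subspace_add by blast
      thus ?thesis by simp
    next
      case 3
      hence "t ^ l \<bullet> x \<in> norms" using long[of "Suc l" x] Suc.prems by simp
      then obtain y where y: "y \<in> Y" "t ^ l \<bullet> x - norm \<bullet> y \<in> P" using normsY by blast
      \<comment> \<open>The exponent \<open>p - 1 - l\<close> is the one for which
        \<open>t ^ l\<close> turns \<open>t ^ (p - 1 - l) \<bullet> y\<close> into the norm of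
        \<open>y\<close> modulo \<open>P\<close>.\<close>
      have tt: "t ^ (p - 1) = t ^ l * t ^ (p - 1 - l)"
        using Suc.prems(1) by (simp only: power_add[symmetric]) simp
      have "t ^ l \<bullet> x - t ^ (p - 1) \<bullet> y \<in> P"
        using P_diff[OF y(2) t_power_norm[of y]] by simp
      hence "t ^ l \<bullet> (x - t ^ (p - 1 - l) \<bullet> y) \<in> P"
        by (simp only: tt scale_right_diff_distrib scale_scale)
      hence "x - t ^ (p - 1 - l) \<bullet> y \<in> V" using Suc.IH[of "x - t ^ (p - 1 - l) \<bullet> y"] Suc.prems(1)
        by simp
      moreover have "t ^ (p - 1 - l) \<bullet> y \<in> V"
        using y(1) V by (intro subspace_scale) auto
      ultimately have "(x - t ^ (p - 1 - l) \<bullet> y) + t ^ (p - 1 - l) \<bullet> y \<in> V" using V(1) subspace_add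
        by blast
      thus ?thesis by simp
    qed
  qed
  hence "V = UNIV" using t_power_p by blast
  thus ?thesis using Z(1-3) YZ XW unfolding V_def by (intro exI[of _ Z]) blast
qed

end

text \<open>In the application \<open>a\<close> is \<open>\<alpha>\<close>, and \<open>descend\<close> combines Hilbert 90 with Kummer theory.\<close>

locale kummer_module = group_ring_module +
  fixes a :: 'a
  assumes t_squared_a: "t ^ 2 \<bullet> a \<in> P"
    and descend: "norm \<bullet> x \<in> P \<Longrightarrow> \<exists>w j f. f \<in> fixed \<and> t \<bullet> w - (x - [:j:] \<bullet> a - f) \<in> P"
begin

text \<open>Downward induction from \<open>l = p\<close>, where \<open>t ^ (p - 1)\<close> is the
  norm. The bound 3 ensures that \<open>t ^ (l - 1)\<close> contains a factor \<open>t ^ 2\<close>,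
  which kills both the multiple of \<open>a\<close> and the fixed element left over by
  \<open>descend\<close>.\<close>

lemma bottom_is_norm:
  assumes "3 \<le> l" "l \<le> p" "t ^ l \<bullet> x \<in> P"
  shows "t ^ (l - 1) \<bullet> x \<in> norms"
  using assms(2,1,3)
proof (induction arbitrary: x rule: inc_induct)
  case base
  thus ?case using t_power_norm[of x] unfolding norms_def by blast
next
  case (step l)
  have "t ^ (p - 1) \<bullet> x = t ^ (p - 1 - l) \<bullet> (t ^ l \<bullet> x)"
    using step.hyps by (simp only: scale_scale power_add[symmetric]) simp
  hence "t ^ (p - 1) \<bullet> x \<in> P" using step.prems(2) by (simp only: P_act)
  hence "norm \<bullet> x \<in> P" using P_diff[OF _ t_power_norm[of x]] by fastforce
  then obtain w j f where w: "f \<in> fixed" "t \<bullet> w - (x - [:j:] \<bullet> a - f) \<in> P"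
    using descend by blast
  have high: "t ^ m \<bullet> ([:j:] \<bullet> a + f) \<in> P" if "m \<ge> 2" for m
  proof -
    have "m - 2 + 2 = m" "Suc (m - 1) = m" using that by linarith+
    hence m: "t ^ m = t ^ (m - 2) * t ^ 2" "t ^ m = t ^ (m - 1) * t"
      by (metis power_add, metis power_Suc2)
    have "t ^ m \<bullet> a = t ^ (m - 2) \<bullet> (t ^ 2 \<bullet> a)" by (simp only: scale_scale m(1))
    hence "t ^ m \<bullet> a \<in> P" by (simp only: P_act t_squared_a)
    hence 1: "t ^ m \<bullet> ([:j:] \<bullet> a) \<in> P" by (simp only: scale_left_commute[of _ "[:j:]"] P_act)
    have "t ^ m \<bullet> f = t ^ (m - 1) \<bullet> (t \<bullet> f)" by (simp only: scale_scale m(2))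
    hence "t ^ m \<bullet> f \<in> P" using w(1) by (simp only: P_act fixed_def mem_Collect_eq)
    with 1 show ?thesis by (simp only: scale_right_distrib P_add)
  qed
  \<comment> \<open>Used with \<open>m = l\<close>, this shows that the chain of \<open>w\<close>
    has length at most \<open>l + 1\<close>; with \<open>m = l - 1\<close>, that both chains end in
    the same class.\<close>
  have shift: "t ^ m \<bullet> x - t ^ Suc m \<bullet> w \<in> P" if "m \<ge> 2" for m
  proof -
    have "t ^ m \<bullet> (t \<bullet> w - (x - [:j:] \<bullet> a - f)) \<in> P" using w(2) by (rule P_act)
    hence "t ^ Suc m \<bullet> w - t ^ m \<bullet> x + t ^ m \<bullet> ([:j:] \<bullet> a + f) \<in> P"
      by (simp only: scale_right_diff_distrib scale_right_distrib scale_scale power_Suc2) (simp add: algebra_simps)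
    from P_neg[OF P_diff[OF this high[OF that]]] show ?thesis by simp
  qed
  have "t ^ Suc l \<bullet> w \<in> P"
    using P_diff[OF step.prems(2) shift[of l]] step.prems(1) by simp
  hence "t ^ l \<bullet> w \<in> norms" using step.IH[of w] step.prems(1) by simp
  moreover have "t ^ (l - 1) \<bullet> x - t ^ l \<bullet> w \<in> P"
    using shift[of "l - 1"] step.prems(1) by simp
  ultimately show ?case using subspace_congD[OF subspace_norms P_subset_norms] by blast
qed

text \<open>A single \<open>t\<close> does not kill \<open>a\<close>, so its image stays as a
  correction. What remains is \<open>t ^ 2 \<bullet> w\<close> with \<open>t ^ 3 \<bullet> w\<close>
  in \<open>P\<close>, to which the preceding lemma applies with \<open>l = 3\<close>; this needs
  \<open>p\<close> to be at least 3.\<close>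

lemma image_t_Int_fixed:
  assumes "t ^ 2 \<bullet> x \<in> P" "p \<ge> 3"
  shows "\<exists>j. t \<bullet> x - t \<bullet> ([:j:] \<bullet> a) \<in> norms"
proof -
  have "p - 3 + 2 = p - 1" using assms(2) by linarith
  hence "t ^ (p - 1) \<bullet> x = t ^ (p - 3) \<bullet> (t ^ 2 \<bullet> x)"
    by (simp only: scale_scale power_add[symmetric])
  hence "t ^ (p - 1) \<bullet> x \<in> P" using assms(1) by (simp only: P_act)
  hence "norm \<bullet> x \<in> P" using P_diff[OF _ t_power_norm[of x]] by fastforce
  then obtain w j f where w: "f \<in> fixed" "t \<bullet> w - (x - [:j:] \<bullet> a - f) \<in> P"
    using descend by blast
  have "t \<bullet> (t \<bullet> w - (x - [:j:] \<bullet> a - f)) \<in> P" using w(2) by (rule P_act)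
  hence "t ^ 2 \<bullet> w - (t \<bullet> x - t \<bullet> ([:j:] \<bullet> a)) + t \<bullet> f \<in> P"
    by (simp only: scale_right_diff_distrib scale_right_distrib scale_scale power2_eq_square) (simp add: algebra_simps)
  moreover have "t \<bullet> f \<in> P" using w(1) by (simp only: fixed_def mem_Collect_eq)
  ultimately have *: "t ^ 2 \<bullet> w - (t \<bullet> x - t \<bullet> ([:j:] \<bullet> a)) \<in> P" using P_diff by fastforce
  have "t \<bullet> (t \<bullet> x - t \<bullet> ([:j:] \<bullet> a)) = t ^ 2 \<bullet> x - [:j:] \<bullet> (t ^ 2 \<bullet> a)"
    by (simp only: scale_right_diff_distrib scale_scale power2_eq_square mult_ac)
  hence "t \<bullet> (t \<bullet> x - t \<bullet> ([:j:] \<bullet> a)) \<in> P"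
    using P_diff[OF assms(1) P_act[OF t_squared_a, of "[:j:]"]] by (simp only:)
  moreover have "t \<bullet> (t ^ 2 \<bullet> w - (t \<bullet> x - t \<bullet> ([:j:] \<bullet> a)))
      = t ^ 3 \<bullet> w - t \<bullet> (t \<bullet> x - t \<bullet> ([:j:] \<bullet> a))"
    by (simp only: scale_right_diff_distrib scale_scale power2_eq_square power3_eq_cube mult_ac)
  ultimately have "t ^ 3 \<bullet> w \<in> P" using P_act[OF *, of t] P_add by fastforce
  hence "t ^ 2 \<bullet> w \<in> norms" using bottom_is_norm[of 3 w] assms(2) by simp
  thus ?thesis using subspace_congD'[OF subspace_norms P_subset_norms *] by blast
qed

end

section \<open>Kummer extensions of degree \<open>p\<close>\<close>

locale kummer_extension =
  fixes p :: nat and F :: "'k::field set" and \<xi> a \<alpha> :: 'k and \<sigma> :: "'k \<Rightarrow> 'k"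
  assumes prime_p: "prime p" and p_gt_2: "p > 2"
    and subfield: "is_subfield F"
    and char: "of_nat p \<noteq> (0::'k)"
    and xi: "\<xi> \<in> F" "\<xi> ^ p = 1" "\<xi> \<noteq> 1"
    and a: "a \<in> F" "a \<noteq> 0" "\<alpha> ^ p = a"
    and generated: "\<And>L. is_subfield L \<Longrightarrow> F \<subseteq> L \<Longrightarrow> \<alpha> \<in> L \<Longrightarrow> L = UNIV"
    and aut: "field_aut \<sigma>" and sigma_F: "\<And>x. x \<in> F \<Longrightarrow> \<sigma> x = x" and sigma_alpha: "\<sigma> \<alpha> = \<xi> * \<alpha>"
begin

lemma F_0: "0 \<in> F" and F_1: "1 \<in> F"
  and F_add: "x \<in> F \<Longrightarrow> y \<in> F \<Longrightarrow> x + y \<in> F"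
  and F_mult: "x \<in> F \<Longrightarrow> y \<in> F \<Longrightarrow> x * y \<in> F"
  and F_minus: "x \<in> F \<Longrightarrow> - x \<in> F"
  and F_inverse: "x \<in> F \<Longrightarrow> inverse x \<in> F"
  using subfield by (auto simp: is_subfield_def)

lemma F_sum: "(\<And>i. i \<in> A \<Longrightarrow> f i \<in> F) \<Longrightarrow> sum f A \<in> F"
  by (induction A rule: infinite_finite_induct) (auto intro: F_0 F_add)

lemma F_power: "x \<in> F \<Longrightarrow> x ^ n \<in> F"
  by (induction n) (auto intro: F_1 F_mult)

lemma F_of_nat: "of_nat n \<in> F"
  by (induction n) (auto intro: F_0 F_1 F_add)

lemma sigma_add: "\<sigma> (x + y) = \<sigma> x + \<sigma> y" and sigma_mult: "\<sigma> (x * y) = \<sigma> x * \<sigma> y"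
  and sigma_1: "\<sigma> 1 = 1" and sigma_bij: "bij \<sigma>"
  using aut unfolding field_aut_def by auto

lemma sigma_0: "\<sigma> 0 = 0" using sigma_F F_0 by blast

lemma sigma_nonzero: "x \<noteq> 0 \<Longrightarrow> \<sigma> x \<noteq> 0"
  using injD[OF bij_is_inj[OF sigma_bij], of x 0] by (auto simp: sigma_0)

lemma sigma_inverse: "\<sigma> (inverse x) = inverse (\<sigma> x)"
proof (cases "x = 0")
  case False
  hence "\<sigma> (inverse x) * \<sigma> x = 1" by (simp add: sigma_mult[symmetric] sigma_1)
  thus ?thesis by (metis inverse_unique mult.commute)
qed (simp add: sigma_0)

lemma sigma_divide: "\<sigma> (x / y) = \<sigma> x / \<sigma> y"
  by (simp add: divide_inverse sigma_mult sigma_inverse)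

lemma sigma_power: "\<sigma> (x ^ n) = \<sigma> x ^ n"
  by (induction n) (auto simp: sigma_mult sigma_1)

lemma sigma_sum: "\<sigma> (sum f A) = (\<Sum>i\<in>A. \<sigma> (f i))"
  by (induction A rule: infinite_finite_induct) (auto simp: sigma_0 sigma_add)

lemma sigma_prod: "\<sigma> (prod f A) = (\<Prod>i\<in>A. \<sigma> (f i))"
  by (induction A rule: infinite_finite_induct) (auto simp: sigma_1 sigma_mult)

lemma iter_add: "(\<sigma> ^^ i) (x + y) = (\<sigma> ^^ i) x + (\<sigma> ^^ i) y"
  by (induction i) (auto simp: sigma_add)

lemma iter_mult: "(\<sigma> ^^ i) (x * y) = (\<sigma> ^^ i) x * (\<sigma> ^^ i) y"
  by (induction i) (auto simp: sigma_mult)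

lemma iter_F: "c \<in> F \<Longrightarrow> (\<sigma> ^^ i) c = c"
  by (induction i) (auto simp: sigma_F)

lemma iter_nonzero: "x \<noteq> 0 \<Longrightarrow> (\<sigma> ^^ i) x \<noteq> 0"
  by (induction i) (auto simp: sigma_nonzero)

lemma iter_inverse: "(\<sigma> ^^ i) (inverse x) = inverse ((\<sigma> ^^ i) x)"
  by (induction i) (auto simp: sigma_inverse)

lemma iter_sum: "(\<sigma> ^^ i) (sum f A) = (\<Sum>j\<in>A. (\<sigma> ^^ i) (f j))"
  by (induction i) (auto simp: sigma_sum)

lemma iter_power: "(\<sigma> ^^ i) (x ^ n) = (\<sigma> ^^ i) x ^ n"
  by (induction i) (auto simp: sigma_power)

lemma alpha_nonzero: "\<alpha> \<noteq> 0"
  using a p_gt_2 by auto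

lemma xi_nonzero: "\<xi> \<noteq> 0"
  using xi p_gt_2 by (auto simp: power_0_left)

lemma iter_alpha: "(\<sigma> ^^ i) \<alpha> = \<xi> ^ i * \<alpha>"
  by (induction i) (auto simp: sigma_mult sigma_power sigma_F xi sigma_alpha)

text \<open>The fixed field of the p-th iterate contains F, and it contains \<open>\<alpha>\<close>
  because \<open>\<xi> ^ p = 1\<close>.\<close>

lemma iter_p: "(\<sigma> ^^ p) x = x"
proof -
  have "(\<sigma> ^^ p) (- x) = - x" if "(\<sigma> ^^ p) x = x" for x
    using iter_mult[of p "-1" x] iter_F[OF F_minus[OF F_1], of p] that by simp
  hence "is_subfield {x. (\<sigma> ^^ p) x = x}"
    unfolding is_subfield_def
    by (simp add: iter_add iter_mult iter_inverse iter_F[OF F_0] iter_F[OF F_1])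
  hence "{x. (\<sigma> ^^ p) x = x} = UNIV"
    by (rule generated) (auto simp: iter_F iter_alpha xi)
  thus ?thesis by blast
qed

lemma xi_power_eq_1: "\<xi> ^ i = 1 \<longleftrightarrow> p dvd i"
proof
  assume i: "\<xi> ^ i = 1"
  show "p dvd i"
  proof (rule ccontr)
    assume "\<not> p dvd i"
    hence "coprime i p" using prime_imp_coprime[OF prime_p] by (simp add: coprime_commute)
    moreover have "i \<noteq> 0" using \<open>\<not> p dvd i\<close> by (cases i) auto
    ultimately obtain x y where "i * x = p * y + 1"
      using bezout_nat[of i p] by auto
    hence "\<xi> ^ (i * x) = \<xi> ^ (p * y + 1)" by simp
    hence "\<xi> = 1" by (simp add: power_mult power_add i xi(2))
    thus False using xi(3) by blast
  qed
qed (auto simp: power_mult xi(2))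

lemma sum_powers_root_of_unity:
  fixes x :: 'k
  assumes "x ^ p = 1"
  shows "(\<Sum>j<p. x ^ j) = (if x = 1 then of_nat p else 0)"
  using power_diff_1_eq[of x p] assms by auto

lemma sum_xi_powers: "(\<Sum>j<p. (\<xi> ^ i) ^ j) = (if p dvd i then of_nat p else 0)"
proof -
  have "(\<xi> ^ i) ^ p = 1" by (metis mult.commute power_mult power_one xi(2))
  thus ?thesis by (simp add: sum_powers_root_of_unity xi_power_eq_1)
qed

text \<open>Fourier inversion on Z/p, evaluated at 0. As \<open>p\<close> is nonzero in K, a
  sequence with vanishing transform has \<open>y 0 = 0\<close>; in \<open>root_of_unity\<close> and
  \<open>hilbert_90\<close> this contradicts \<open>y 0 = 1\<close>.\<close>

lemma fourier_coeff_0: "(\<Sum>j<p. \<Sum>i<p. y i * (\<xi> ^ i) ^ j) = of_nat p * y 0"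
proof -
  have "(\<Sum>j<p. \<Sum>i<p. y i * (\<xi> ^ i) ^ j) = (\<Sum>i<p. \<Sum>j<p. y i * (\<xi> ^ i) ^ j)"
    by (rule sum.swap)
  also have "\<dots> = (\<Sum>i<p. if i = 0 then of_nat p * y 0 else 0)"
    by (rule sum.cong) (auto simp: sum_distrib_left[symmetric] sum_xi_powers dest: dvd_imp_le)
  also have "\<dots> = of_nat p * y 0" using p_gt_2 by simp
  finally show ?thesis .
qed

text \<open>If \<open>x\<close> were not a power of \<open>\<xi>\<close>, every
  \<open>x * \<xi> ^ j\<close> would be a p-th root of unity other than 1, with vanishing geometric
  sum; these sums are the transform of the sequence \<open>x ^ i\<close>.\<close>

lemma root_of_unity:
  assumes "x ^ p = 1"
  shows "\<exists>i. x = \<xi> ^ i"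
proof (rule ccontr)
  assume *: "\<nexists>i. x = \<xi> ^ i"
  have "(\<Sum>i<p. x ^ i * (\<xi> ^ i) ^ j) = 0" if "j < p" for j
  proof -
    have "x * \<xi> ^ j \<noteq> 1"
    proof
      assume "x * \<xi> ^ j = 1"
      moreover have "\<xi> ^ (p - j) * \<xi> ^ j = 1" using that by (simp add: power_add[symmetric] xi(2))
      ultimately have "x = \<xi> ^ (p - j)" using xi_nonzero by (metis mult_cancel_right power_not_zero)
      thus False using * by blast
    qed
    moreover have "(x * \<xi> ^ j) ^ p = 1"
      using assms by (metis mult.commute mult_1 power_mult power_mult_distrib power_one xi(2))
    ultimately have "(\<Sum>i<p. (x * \<xi> ^ j) ^ i) = 0" using sum_powers_root_of_unity by auto
    thus ?thesis by (simp add: power_mult_distrib power_mult[symmetric] mult.commute)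
  qed
  hence "(\<Sum>j<p. \<Sum>i<p. x ^ i * (\<xi> ^ i) ^ j) = 0" by simp
  thus False using char by (simp add: fourier_coeff_0)
qed

section \<open>The ring \<open>F[\<alpha>]\<close> and the fixed field of
  \<open>\<sigma>\<close>\<close>

definition F_alpha :: "'k set" where
  "F_alpha = {poly q \<alpha> | q. \<forall>i. coeff q i \<in> F}"

lemma F_subset_F_alpha: "c \<in> F \<Longrightarrow> c \<in> F_alpha"
  unfolding F_alpha_def using F_0
  by (intro CollectI exI[of _ "[:c:]"]) (auto simp: coeff_pCons split: nat.split)

lemma alpha_in_F_alpha: "\<alpha> \<in> F_alpha"
  unfolding F_alpha_def using F_0 F_1
  by (intro CollectI exI[of _ "[:0, 1:]"]) (auto simp: coeff_pCons split: nat.split)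

lemma F_alpha_add: "x \<in> F_alpha \<Longrightarrow> y \<in> F_alpha \<Longrightarrow> x + y \<in> F_alpha"
proof -
  assume "x \<in> F_alpha" "y \<in> F_alpha"
  then obtain q r where "x = poly q \<alpha>" "y = poly r \<alpha>" "\<And>i. coeff q i \<in> F" "\<And>i. coeff r i \<in> F"
    unfolding F_alpha_def by blast
  thus ?thesis unfolding F_alpha_def
    by (intro CollectI exI[of _ "q + r"]) (auto intro!: F_add)
qed

lemma F_alpha_mult: "x \<in> F_alpha \<Longrightarrow> y \<in> F_alpha \<Longrightarrow> x * y \<in> F_alpha"
proof -
  assume "x \<in> F_alpha" "y \<in> F_alpha"
  then obtain q r where "x = poly q \<alpha>" "y = poly r \<alpha>" "\<And>i. coeff q i \<in> F" "\<And>i. coeff r i \<in> F"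
    unfolding F_alpha_def by blast
  thus ?thesis unfolding F_alpha_def
    by (intro CollectI exI[of _ "q * r"]) (auto simp: coeff_mult intro!: F_sum F_mult)
qed

lemma F_alpha_sum: "(\<And>i. i \<in> A \<Longrightarrow> f i \<in> F_alpha) \<Longrightarrow> sum f A \<in> F_alpha"
  by (induction A rule: infinite_finite_induct) (auto intro: F_subset_F_alpha F_0 F_alpha_add)

lemma F_alpha_prod: "(\<And>i. i \<in> A \<Longrightarrow> f i \<in> F_alpha) \<Longrightarrow> prod f A \<in> F_alpha"
  by (induction A rule: infinite_finite_induct) (auto intro: F_subset_F_alpha F_1 F_alpha_mult)

lemma iter_F_alpha:
  assumes "x \<in> F_alpha"
  shows "(\<sigma> ^^ j) x \<in> F_alpha"
proof -
  obtain q where q: "x = poly q \<alpha>" "\<And>i. coeff q i \<in> F" using assms unfolding F_alpha_def by blast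
  \<comment> \<open>The power \<open>(\<xi> ^ j * \<alpha>) ^ i\<close> is written as a product so
    that closure under products applies.\<close>
  have "(\<sigma> ^^ j) x = (\<Sum>i\<le>degree q. coeff q i * (\<Prod>k<i. \<xi> ^ j * \<alpha>))"
    unfolding q(1) poly_altdef by (simp add: iter_sum iter_mult iter_power iter_F q(2) iter_alpha)
  also have "\<dots> \<in> F_alpha"
    by (intro F_alpha_sum F_alpha_mult F_alpha_prod alpha_in_F_alpha F_subset_F_alpha[OF q(2)]
        F_subset_F_alpha[OF F_power[OF xi(1)]])
  finally show ?thesis .
qed

text \<open>The trace of \<open>\<alpha> ^ i\<close> contains the sum of the powers of
  \<open>\<xi> ^ i\<close>; it vanishes unless \<open>p\<close> divides \<open>i\<close>, and then
  \<open>\<alpha> ^ i\<close> is a power of \<open>a\<close>.\<close>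

lemma trace_in_F:
  assumes "x \<in> F_alpha"
  shows "(\<Sum>j<p. (\<sigma> ^^ j) x) \<in> F"
proof -
  obtain q where q: "x = poly q \<alpha>" "\<And>i. coeff q i \<in> F" using assms unfolding F_alpha_def by blast
  have "(\<Sum>j<p. (\<sigma> ^^ j) x) = (\<Sum>j<p. \<Sum>i\<le>degree q. coeff q i * (\<alpha> ^ i * (\<xi> ^ i) ^ j))"
    unfolding q(1) poly_altdef
    by (simp add: iter_sum iter_mult iter_power iter_F q(2) iter_alpha power_mult_distrib
        power_mult[symmetric] mult.commute)
  also have "\<dots> = (\<Sum>i\<le>degree q. coeff q i * (\<alpha> ^ i * (\<Sum>j<p. (\<xi> ^ i) ^ j)))"
    by (subst sum.swap) (simp add: sum_distrib_left)
  also have "\<dots> \<in> F"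
  proof (intro F_sum F_mult[OF q(2)])
    fix i
    show "\<alpha> ^ i * (\<Sum>j<p. (\<xi> ^ i) ^ j) \<in> F"
      using F_power[OF a(1)]
        by (auto simp: sum_xi_powers power_mult a(3) intro!: F_mult F_of_nat F_0)
  qed
  finally show ?thesis .
qed

lemma fixed_F_alpha_in_F:
  assumes "x \<in> F_alpha" "\<sigma> x = x"
  shows "x \<in> F"
proof -
  have "(\<sigma> ^^ j) x = x" for j by (induction j) (auto simp: assms(2))
  hence "of_nat p * x \<in> F" using trace_in_F[OF assms(1)] by simp
  hence "inverse (of_nat p) * (of_nat p * x) \<in> F" by (rule F_mult[OF F_inverse[OF F_of_nat]])
  moreover have "inverse (of_nat p) * (of_nat p * x) = x" using char by simp
  ultimately show ?thesis by simp
qed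

lemma knorm_F: "c \<in> F \<Longrightarrow> knorm p \<sigma> c = c ^ p"
  unfolding knorm_def by (simp add: iter_F)

lemma knorm_0: "knorm p \<sigma> 0 = 0"
  using knorm_F[OF F_0] p_gt_2 by auto

lemma sigma_knorm: "\<sigma> (knorm p \<sigma> x) = knorm p \<sigma> x"
proof -
  \<comment> \<open>A product of \<open>p + 1\<close> conjugates is split once at its first factor
    and once at its last, where the p-th iterate is the identity.\<close>
  have "\<sigma> (knorm p \<sigma> x) * (\<sigma> ^^ 0) x = (\<Prod>i<Suc p. (\<sigma> ^^ i) x)"
    unfolding knorm_def sigma_prod prod.lessThan_Suc_shift by (simp add: mult.commute)
  also have "\<dots> = knorm p \<sigma> x * x" unfolding knorm_def by (simp add: iter_p)
  finally show ?thesis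
    by (cases "x = 0") (auto simp: knorm_0 sigma_0)
qed

lemma knorm_nonzero: "x \<noteq> 0 \<Longrightarrow> knorm p \<sigma> x \<noteq> 0"
  unfolding knorm_def by (simp add: iter_nonzero)

text \<open>Only inverses are an issue. The remaining conjugates of \<open>x\<close> multiply to
  some \<open>y\<close> with \<open>x * y\<close> the norm of \<open>x\<close>; being a fixed
  element of \<open>F[\<alpha>]\<close>, the norm lies in F and can be inverted there.\<close>

lemma F_alpha_UNIV: "F_alpha = UNIV"
proof (rule generated)
  have inverse: "inverse x \<in> F_alpha" if x: "x \<in> F_alpha" "x \<noteq> 0" for x
  proof -
    define y where "y = (\<Prod>i\<in>{1..<p}. (\<sigma> ^^ i) x)"
    have y: "y \<in> F_alpha" unfolding y_def using x(1) by (intro F_alpha_prod iter_F_alpha)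
    have "{..<p} = insert 0 {1..<p}" using p_gt_2 by auto
    hence xy: "knorm p \<sigma> x = x * y" unfolding knorm_def y_def by simp
    have "knorm p \<sigma> x \<in> F"
      by (rule fixed_F_alpha_in_F[OF _ sigma_knorm]) (simp add: xy F_alpha_mult x(1) y)
    hence "inverse (x * y) \<in> F" using F_inverse unfolding xy by blast
    moreover have "inverse x = inverse (x * y) * y"
      using knorm_nonzero[OF x(2)] unfolding xy by (simp add: field_simps)
    ultimately show ?thesis using y by (metis F_alpha_mult F_subset_F_alpha)
  qed
  have "- x \<in> F_alpha" if "x \<in> F_alpha" for x
    using F_alpha_mult[OF F_subset_F_alpha[OF F_minus[OF F_1]] that] by simp
  thus "is_subfield F_alpha" unfolding is_subfield_def
    using inverse F_alpha_add F_alpha_mult F_subset_F_alpha F_0 F_1 by blast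
qed (use F_subset_F_alpha alpha_in_F_alpha in blast)+

lemma fixed_in_F: "\<sigma> x = x \<Longrightarrow> x \<in> F"
  by (rule fixed_F_alpha_in_F) (simp_all add: F_alpha_UNIV)

lemma knorm_in_F: "knorm p \<sigma> x \<in> F"
  by (intro fixed_in_F sigma_knorm)

lemma knorm_mult: "knorm p \<sigma> (x * y) = knorm p \<sigma> x * knorm p \<sigma> y"
  unfolding knorm_def by (simp add: iter_mult prod.distrib)

lemma knorm_inverse: "knorm p \<sigma> (inverse x) = inverse (knorm p \<sigma> x)"
  unfolding knorm_def by (simp add: iter_inverse prod_inversef[symmetric] o_def)

lemma knorm_power: "knorm p \<sigma> (x ^ n) = knorm p \<sigma> x ^ n"
  unfolding knorm_def by (simp add: iter_power prod_power_distrib)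

text \<open>The conjugates contribute the extra factor
  \<open>\<xi> ^ (0 + ... + (p - 1)) = \<xi> ^ (p * m)\<close> with \<open>p = 2 * m + 1\<close>,
  which is 1.\<close>

lemma knorm_alpha: "knorm p \<sigma> \<alpha> = a"
proof -
  have "odd p" using prime_p p_gt_2 by (simp add: prime_odd_nat)
  then obtain m where m: "p = 2 * m + 1" by (elim oddE)
  have "(\<Prod>i<n. \<xi> ^ i) = \<xi> ^ (\<Sum>i<n. i)" for n by (simp add: power_sum)
  moreover have "(\<Sum>i<2 * m + 1. i) = (2 * m + 1) * m" for m :: nat
    by (induction m) (auto simp: algebra_simps)
  ultimately have "(\<Prod>i<p. \<xi> ^ i) = \<xi> ^ (p * m)" using m by metis
  thus ?thesis unfolding knorm_def
    by (simp add: iter_alpha prod.distrib a(3) power_mult xi(2))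
qed

lemma knorm_sigma_divide: "x \<noteq> 0 \<Longrightarrow> knorm p \<sigma> (\<sigma> x / x) = 1"
proof -
  assume x: "x \<noteq> 0"
  have "knorm p \<sigma> (\<sigma> x) = \<sigma> (knorm p \<sigma> x)"
    unfolding knorm_def sigma_prod by (rule prod.cong) (auto simp: funpow_swap1)
  thus ?thesis using knorm_nonzero[OF x]
    by (simp add: divide_inverse knorm_mult knorm_inverse sigma_knorm)
qed

text \<open>Hilbert's Theorem 90. The resolvent is nonzero for some \<open>\<theta> = \<alpha>\<^sup>j\<close>, since these resolvents,
  divided by \<open>\<alpha>\<^sup>j\<close>, add up to \<open>p\<close>.\<close>

lemma hilbert_90:
  assumes "knorm p \<sigma> x = 1"
  shows "\<exists>w. w \<noteq> 0 \<and> x = \<sigma> w / w"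
proof -
  define y where "y i = (\<Prod>k<i. (\<sigma> ^^ k) x)" for i
  define r where "r \<theta> = (\<Sum>i<p. y i * (\<sigma> ^^ i) \<theta>)" for \<theta>
  have y_Suc: "x * \<sigma> (y i) = y (Suc i)" for i
    unfolding y_def sigma_prod prod.lessThan_Suc_shift by simp
  have r: "x * \<sigma> (r \<theta>) = r \<theta>" for \<theta>
  proof -
    have "x * \<sigma> (r \<theta>) = (\<Sum>i<p. y (Suc i) * (\<sigma> ^^ Suc i) \<theta>)"
      unfolding r_def sigma_sum sum_distrib_left
      by (rule sum.cong) (simp_all add: sigma_mult y_Suc[symmetric] mult.assoc)
    hence "x * \<sigma> (r \<theta>) + y 0 * (\<sigma> ^^ 0) \<theta> = (\<Sum>i<Suc p. y i * (\<sigma> ^^ i) \<theta>)"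
      by (subst sum.lessThan_Suc_shift) simp
    also have "\<dots> = r \<theta> + y p * (\<sigma> ^^ p) \<theta>" unfolding r_def by simp
    also have "y p = 1" using assms unfolding y_def knorm_def by simp
    finally show ?thesis by (simp add: iter_p y_def)
  qed
  have "\<exists>j<p. r (\<alpha> ^ j) \<noteq> 0"
  proof (rule ccontr)
    assume *: "\<not> ?thesis"
    have "(\<Sum>i<p. y i * (\<xi> ^ i) ^ j) = 0" if "j < p" for j
    proof -
      have "r (\<alpha> ^ j) = (\<Sum>i<p. y i * (\<xi> ^ i) ^ j) * \<alpha> ^ j"
        unfolding r_def
          by (simp add: iter_power iter_alpha power_mult_distrib sum_distrib_right mult.assoc)
      thus ?thesis using * that alpha_nonzero by auto
    qed
    hence "(\<Sum>j<p. \<Sum>i<p. y i * (\<xi> ^ i) ^ j) = 0" by simp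
    thus False using char by (simp add: fourier_coeff_0 y_def)
  qed
  then obtain j where j: "r (\<alpha> ^ j) \<noteq> 0" by blast
  let ?w = "inverse (r (\<alpha> ^ j))"
  have "x = r (\<alpha> ^ j) / \<sigma> (r (\<alpha> ^ j))"
    using r[of "\<alpha> ^ j"] sigma_nonzero[OF j] by (simp add: nonzero_eq_divide_eq)
  hence "x = \<sigma> ?w / ?w" by (simp add: sigma_inverse divide_inverse mult.commute)
  thus ?thesis using j by (intro exI[of _ ?w]) simp
qed

text \<open>\<open>\<sigma> d / d\<close> is a p-th root of unity, so it equals the corresponding
  quotient for some power of \<open>\<alpha>\<close>; dividing by that power gives a fixed
  element.\<close>

lemma kummer_kernel:
  assumes "d ^ p \<in> F" "d \<noteq> 0"
  shows "\<exists>i g. g \<in> F \<and> g \<noteq> 0 \<and> d = \<alpha> ^ i * g"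
proof -
  have "(\<sigma> d / d) ^ p = 1"
    using assms by (simp add: power_divide sigma_power[symmetric] sigma_F)
  then obtain i where "\<sigma> d / d = \<xi> ^ i" using root_of_unity by blast
  hence i: "\<sigma> d = \<xi> ^ i * d" using assms(2) by (simp add: field_simps)
  have "\<sigma> (d / \<alpha> ^ i) = d / \<alpha> ^ i"
    using i xi_nonzero by (simp add: sigma_divide sigma_power sigma_alpha power_mult_distrib)
  hence "d / \<alpha> ^ i \<in> F" by (rule fixed_in_F)
  thus ?thesis using assms(2) alpha_nonzero by (intro exI[of _ i] exI[of _ "d / \<alpha> ^ i"]) simp
qed

text \<open>A p-th power \<open>d ^ p\<close> lying in F is the norm of \<open>d\<close> itself:
  \<open>d = \<alpha> ^ i * g\<close>, the norm of \<open>\<alpha>\<close> is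
  \<open>\<alpha> ^ p\<close>, and that of \<open>g\<close> is \<open>g ^ p\<close>. So
  \<open>x / d\<close> has norm 1.\<close>

lemma norm_power_imp_descend:
  assumes "x \<noteq> 0" "knorm p \<sigma> x = d ^ p"
  shows "\<exists>w i g. w \<noteq> 0 \<and> g \<in> F \<and> g \<noteq> 0 \<and> \<sigma> w / w = x / (\<alpha> ^ i * g)"
proof -
  have d: "d \<noteq> 0" using knorm_nonzero[OF assms(1)] assms(2) p_gt_2 by auto
  have "d ^ p \<in> F" using knorm_in_F[of x] assms(2) by simp
  then obtain i g where ig: "g \<in> F" "g \<noteq> 0" "d = \<alpha> ^ i * g" using kummer_kernel[OF _ d] by blast
  have "knorm p \<sigma> (\<alpha> ^ i * g) = d ^ p"
    unfolding ig(3)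
      by (simp add: knorm_mult knorm_power knorm_alpha knorm_F ig(1) power_mult_distrib
        a(3)[symmetric] power_mult[symmetric] mult.commute)
  hence "knorm p \<sigma> (x / (\<alpha> ^ i * g)) = 1"
    using d assms(2)
      by (simp add: divide_inverse knorm_mult knorm_inverse del: inverse_mult_distrib)
  from hilbert_90[OF this] ig(1,2) show ?thesis by metis
qed

text \<open>Hilbert 90 applies because the norm of \<open>\<delta> ^ p\<close> is
  \<open>\<xi> ^ p = 1\<close>. If \<open>\<gamma>\<close> were a norm times \<open>d ^ p\<close>,
  then \<open>\<delta>\<close> and \<open>\<sigma> d / d\<close> would have the same p-th power and
  so differ by a power of \<open>\<xi>\<close>; both that power and \<open>\<sigma> d / d\<close>
  have norm 1.\<close>

lemma xi_norm_imp_fixed_nonnorm: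
  assumes "knorm p \<sigma> \<delta> = \<xi>"
  shows "\<exists>\<gamma>. \<gamma> \<noteq> 0 \<and> \<sigma> \<gamma> = \<gamma> * \<delta> ^ p \<and> (\<forall>\<beta> d. d \<noteq> 0 \<longrightarrow> \<gamma> \<noteq> knorm p \<sigma> \<beta> * d ^ p)"
proof -
  have "knorm p \<sigma> (\<delta> ^ p) = 1" by (simp add: knorm_power assms xi(2))
  then obtain \<gamma> where \<gamma>: "\<gamma> \<noteq> 0" "\<delta> ^ p = \<sigma> \<gamma> / \<gamma>" using hilbert_90 by blast
  have "\<gamma> \<noteq> knorm p \<sigma> \<beta> * d ^ p" if d: "d \<noteq> 0" for \<beta> d
  proof
    assume g: "\<gamma> = knorm p \<sigma> \<beta> * d ^ p"
    hence "\<delta> ^ p = (\<sigma> d / d) ^ p"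
      using \<gamma> by (simp add: sigma_mult sigma_knorm sigma_power power_divide)
    moreover have "\<sigma> d / d \<noteq> 0" using d sigma_nonzero by auto
    ultimately have "(\<delta> / (\<sigma> d / d)) ^ p = 1" by (simp only: power_divide) simp
    then obtain i where "\<delta> / (\<sigma> d / d) = \<xi> ^ i" using root_of_unity by blast
    hence "\<delta> = \<xi> ^ i * (\<sigma> d / d)" using \<open>\<sigma> d / d \<noteq> 0\<close> by (simp add: field_simps)
    hence "knorm p \<sigma> \<delta> = 1"
      using knorm_sigma_divide[OF d] knorm_F[OF xi(1)]
        by (simp only: knorm_mult knorm_power xi(2)) simp
    thus False using assms xi(3) by simp
  qed
  thus ?thesis using \<gamma> by (intro exI[of _ \<gamma>]) simp
qed

text \<open>The theorem distinguishes cases by \<open>\<xi>\<close>, the module sees only the class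
  of \<open>\<xi>\<close>. The two criteria agree because the leftover factor \<open>d ^ p\<close>
  lies in F and is therefore the norm of \<open>d\<close>.\<close>

lemma xi_norm_mod_powers:
  assumes "\<xi> = knorm p \<sigma> \<beta> * d ^ p" "d \<noteq> 0"
  shows "\<exists>g. g \<noteq> 0 \<and> knorm p \<sigma> g = \<xi>"
proof -
  have b: "\<beta> \<noteq> 0" using assms(1) xi_nonzero knorm_F[OF F_0] p_gt_2 by auto
  have "d ^ p = \<xi> * inverse (knorm p \<sigma> \<beta>)" using assms(1) knorm_nonzero[OF b]
    by (simp add: field_simps)
  hence "d ^ p \<in> F" using xi(1) knorm_in_F by (simp add: F_mult F_inverse)
  then obtain i g where ig: "g \<in> F" "g \<noteq> 0" "d = \<alpha> ^ i * g" using kummer_kernel[OF _ assms(2)]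
    by blast
  have "knorm p \<sigma> (\<alpha> ^ i * g) = d ^ p"
    unfolding ig(3)
      by (simp add: knorm_mult knorm_power knorm_alpha knorm_F ig(1) power_mult_distrib
        a(3)[symmetric] power_mult[symmetric] mult.commute)
  hence "knorm p \<sigma> (\<beta> * d) = \<xi>" using assms(1) ig(3) by (simp add: knorm_mult)
  thus ?thesis using b assms(2) by (intro exI[of _ "\<beta> * d"]) simp
qed

end

section \<open>The multiplicative group as a module\<close>

text \<open>The module locale asks for a type that is an additive group, so the units of the field
  become a type of their own with multiplication written as \<open>+\<close>.\<close>

typedef (overloaded) 'k mgroup = "{x::'k::field. x \<noteq> 0}"
  morphisms val mk by (rule exI[of _ 1]) simp

lemma val_nonzero [simp]: "val x \<noteq> 0"
  using val[of x] by simp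

lemma val_mk [simp]: "y \<noteq> 0 \<Longrightarrow> val (mk y) = y"
  by (simp add: mk_inverse)

instantiation mgroup :: (field) ab_group_add
begin

definition "0 = mk 1"
definition "x + y = mk (val x * val y)"
definition "- x = mk (inverse (val x))"
definition "x - y = mk (val x / val y)"

instance
  by standard (simp_all add: zero_mgroup_def plus_mgroup_def uminus_mgroup_def minus_mgroup_def
      val_inject[symmetric] mult_ac divide_inverse)

end

lemma val_0 [simp]: "val 0 = 1" and val_add [simp]: "val (x + y) = val x * val y"
  and val_uminus [simp]: "val (- x) = inverse (val x)"
    and val_diff [simp]: "val (x - y) = val x / val y"
  by (simp_all add: zero_mgroup_def plus_mgroup_def uminus_mgroup_def minus_mgroup_def)

lemma val_sum: "val (sum f A) = (\<Prod>i\<in>A. val (f i))"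
  by (induction A rule: infinite_finite_induct) auto

definition mscale :: "int \<Rightarrow> 'k::field mgroup \<Rightarrow> 'k mgroup" where
  "mscale k x = mk (val x powi k)"

lemma val_mscale [simp]: "val (mscale k x) = val x powi k"
  unfolding mscale_def by (simp add: power_int_eq_0_iff)

interpretation mscale: module mscale
proof
  show "mscale a (mscale b x) = mscale (a * b) x" for a b and x :: "'a mgroup"
    by (simp add: val_inject[symmetric] power_int_mult[symmetric] mult.commute)
qed (simp_all add: val_inject[symmetric] power_int_add power_int_mult_distrib)

text \<open>An endomorphism of an R-module turns it into an R[X]-module with X acting as
  \<open>s\<close>. The action is given by Horner's scheme, so that its laws follow by induction
  along \<open>pCons\<close>. Below, R is the ring of integers and \<open>s\<close> is
  \<open>\<sigma>\<close>.\<close>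

locale module_endomorphism = module scale
  for scale :: "'r::comm_ring_1 \<Rightarrow> 'a::ab_group_add \<Rightarrow> 'a" (infixr \<open>*s\<close> 75) +
  fixes s :: "'a \<Rightarrow> 'a"
  assumes s_add: "s (x + y) = s x + s y" and s_scale: "s (k *s x) = k *s s x"
begin

definition poly_act :: "'r poly \<Rightarrow> 'a \<Rightarrow> 'a" where
  "poly_act f x = fold_coeffs (\<lambda>c y. c *s x + s y) f 0"

lemma s_0: "s 0 = 0"
  using s_add[of 0 0] by simp

lemma poly_act_0 [simp]: "poly_act 0 x = 0"
  by (simp add: poly_act_def)

lemma poly_act_pCons [simp]: "poly_act (pCons c f) x = c *s x + s (poly_act f x)"
  by (cases "c = 0 \<and> f = 0") (auto simp: poly_act_def s_0)

lemma poly_act_add_right: "poly_act f (x + y) = poly_act f x + poly_act f y"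
  by (induction f) (auto simp: s_add scale_right_distrib)

lemma poly_act_add_left: "poly_act (f + g) x = poly_act f x + poly_act g x"
  by (induction f g rule: poly_induct2) (auto simp: s_add scale_left_distrib)

lemma poly_act_smult: "poly_act (smult c f) x = c *s poly_act f x"
  by (induction f) (auto simp: s_scale scale_right_distrib)

lemma poly_act_mult: "poly_act (f * g) x = poly_act f (poly_act g x)"
  by (induction f) (auto simp: poly_act_add_left poly_act_smult)

lemma module_poly_act: "module poly_act"
  by standard (simp_all add: poly_act_add_left poly_act_add_right poly_act_mult one_pCons s_0)

lemma poly_act_monom: "poly_act (monom c i) x = c *s (s ^^ i) x"
  by (induction i) (auto simp: monom_0 monom_Suc s_0 s_scale)

end

context kummer_extension begin

definition msigma :: "'k mgroup \<Rightarrow> 'k mgroup" where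
  "msigma x = mk (\<sigma> (val x))"

lemma val_msigma [simp]: "val (msigma x) = \<sigma> (val x)"
  unfolding msigma_def by (simp add: sigma_nonzero)

lemma val_msigma_iter [simp]: "val ((msigma ^^ i) x) = (\<sigma> ^^ i) (val x)"
  by (induction i) auto

lemma sigma_power_int: "\<sigma> (x powi k) = \<sigma> x powi k"
  by (simp add: power_int_def sigma_power sigma_inverse)

sublocale msigma: module_endomorphism mscale msigma
  by standard (simp_all add: val_inject[symmetric] sigma_mult sigma_power_int)

abbreviation act :: "int poly \<Rightarrow> 'k mgroup \<Rightarrow> 'k mgroup" where
  "act \<equiv> msigma.poly_act"

lemma act_const: "act [:k:] x = mscale k x"
  by (simp add: msigma.s_0)

definition powers :: "'k mgroup set" where
  "powers = range (\<lambda>x. act [:int p:] x)"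

lemma mem_powers: "x \<in> powers \<longleftrightarrow> (\<exists>d. d \<noteq> 0 \<and> val x = d ^ p)"
proof
  assume "x \<in> powers"
  then obtain y where "x = mscale (int p) y" unfolding powers_def act_const by blast
  thus "\<exists>d. d \<noteq> 0 \<and> val x = d ^ p" by (intro exI[of _ "val y"]) simp
next
  assume "\<exists>d. d \<noteq> 0 \<and> val x = d ^ p"
  then obtain d where "d \<noteq> 0" "val x = d ^ p" by blast
  hence "x = act [:int p:] (mk d)"
    by (simp add: act_const val_inject[symmetric] del: msigma.poly_act_pCons)
  thus "x \<in> powers" unfolding powers_def by blast
qed

lemma p_odd: "odd p"
  using prime_p p_gt_2 by (simp add: prime_odd_nat)

lemma val_norm: "val (act (norm_poly p) x) = knorm p \<sigma> (val x)"
proof -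
  interpret module act by (rule msigma.module_poly_act)
  show ?thesis
    by (simp add: norm_poly_def scale_sum_left msigma.poly_act_monom val_sum knorm_def)
qed

lemma val_t: "val (act [:-1, 1:] x) = \<sigma> (val x) / val x"
  by (simp add: msigma.s_0 divide_inverse mult.commute)

definition malpha :: "'k mgroup" where "malpha = mk \<alpha>"

lemma val_malpha [simp]: "val malpha = \<alpha>"
  by (simp add: malpha_def alpha_nonzero)

lemma group_ring_module_powers: "group_ring_module act p powers"
proof -
  interpret module act by (rule msigma.module_poly_act)
  show ?thesis
  proof
    show "subspace powers"
    proof (rule subspaceI)
      show "0 \<in> powers" unfolding mem_powers by (intro exI[of _ 1]) simp
      show "x + y \<in> powers" if "x \<in> powers" "y \<in> powers" for x y
        using that unfolding powers_def
          by (metis (no_types, lifting) rangeE rangeI scale_right_distrib)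
      show "act f x \<in> powers" if "x \<in> powers" for f x
        using that unfolding powers_def
          by (metis (no_types, lifting) rangeE rangeI scale_left_commute)
    qed
    show "act [:int p:] x \<in> powers" for x unfolding powers_def by blast
    have "act (monom 1 p - 1) x = 0" for x
      by (simp add: scale_left_diff_distrib msigma.poly_act_monom val_inject[symmetric] iter_p)
    thus "act (monom 1 p - 1) x \<in> powers" for x unfolding mem_powers by (intro exI[of _ 1]) simp
  qed (simp_all add: prime_p p_odd)
qed

sublocale grm: group_ring_module act p powers
  by (rule group_ring_module_powers)

lemma mem_fixed: "x \<in> grm.fixed \<longleftrightarrow> (\<exists>d. d \<noteq> 0 \<and> \<sigma> (val x) / val x = d ^ p)"
  unfolding grm.fixed_def mem_Collect_eq mem_powers val_t ..

lemma mem_norms: "x \<in> grm.norms \<longleftrightarrow> (\<exists>\<beta> d. \<beta> \<noteq> 0 \<and> d \<noteq> 0 \<and> val x = knorm p \<sigma> \<beta> * d ^ p)"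
proof
  assume "x \<in> grm.norms"
  then obtain y where "x - act (norm_poly p) y \<in> powers" unfolding grm.norms_def by blast
  then obtain d where "d \<noteq> 0" "val x / knorm p \<sigma> (val y) = d ^ p"
    unfolding mem_powers by (auto simp: val_norm)
  thus "\<exists>\<beta> d. \<beta> \<noteq> 0 \<and> d \<noteq> 0 \<and> val x = knorm p \<sigma> \<beta> * d ^ p"
    using knorm_nonzero[of "val y"]
      by (intro exI[of _ "val y"] exI[of _ d]) (auto simp: field_simps)
next
  assume "\<exists>\<beta> d. \<beta> \<noteq> 0 \<and> d \<noteq> 0 \<and> val x = knorm p \<sigma> \<beta> * d ^ p"
  then obtain \<beta> d where "\<beta> \<noteq> 0" "d \<noteq> 0" "val x = knorm p \<sigma> \<beta> * d ^ p" by blast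
  hence "x - act (norm_poly p) (mk \<beta>) \<in> powers"
    using knorm_nonzero[of \<beta>] unfolding mem_powers by (intro exI[of _ d]) (auto simp: val_norm)
  thus "x \<in> grm.norms" unfolding grm.norms_def by blast
qed

sublocale km: kummer_module act p powers malpha
proof
  \<comment> \<open>The first \<open>t\<close> sends \<open>\<alpha>\<close> to
    \<open>\<xi>\<close>; this lies in F, so the second one sends it to 1.\<close>
  have "val (act ([:-1, 1:] ^ 2) malpha) = 1"
    unfolding power2_eq_square grm.scale_scale[symmetric] val_t
    by (simp add: sigma_alpha alpha_nonzero sigma_F xi xi_nonzero)
  thus "act ([:-1, 1:] ^ 2) malpha \<in> powers" unfolding mem_powers by (intro exI[of _ 1]) simp
next
  fix x assume "act (norm_poly p) x \<in> powers"
  then obtain d where "knorm p \<sigma> (val x) = d ^ p" unfolding mem_powers val_norm by blast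
  from norm_power_imp_descend[OF val_nonzero this]
  obtain w i g where w: "w \<noteq> 0" "g \<in> F" "g \<noteq> 0" "\<sigma> w / w = val x / (\<alpha> ^ i * g)" by blast
  have "act [:-1, 1:] (mk w) = x - act [:int i:] malpha - mk g"
    using w by (simp add: val_inject[symmetric] val_t act_const del: msigma.poly_act_pCons)
  hence "act [:-1, 1:] (mk w) - (x - act [:int i:] malpha - mk g) \<in> powers"
    using grm.P_0 by (simp del: msigma.poly_act_pCons)
  moreover have "mk g \<in> grm.fixed"
    unfolding mem_fixed using w by (intro exI[of _ 1]) (simp add: sigma_F)
  ultimately show "\<exists>w j f. f \<in> grm.fixed \<and> act [:-1, 1:] w - (x - act [:j:] malpha - f) \<in> powers"
    by blast
qed

end

section \<open>Submodules of \<open>J\<close>\<close>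

lemma eqpoll_fcoeffs_infinite:
  assumes "infinite B" "p \<ge> 2"
  shows "fcoeffs p B \<approx> B"
proof (rule lepoll_antisym)
  have "fcoeffs p B \<subseteq> {f. f ` B \<subseteq> {..<p} \<and> {x. f x \<noteq> 0} \<subseteq> B \<and> finite {x. f x \<noteq> 0}}"
    unfolding fcoeffs_def by auto
  hence "fcoeffs p B \<lesssim> {f. f ` B \<subseteq> {..<p} \<and> {x. f x \<noteq> 0} \<subseteq> B \<and> finite {x. f x \<noteq> 0}}"
    by (rule subset_imp_lepoll)
  \<comment> \<open>A function of finite support is determined by its graph over the support, a
    finite subset of the product.\<close>
  also have "\<dots> \<lesssim> Fpow (B \<times> {..<p})"
    by (rule lepoll_restricted_funspace)
  also have "\<dots> \<approx> B \<times> {..<p}"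
    using assms by (intro eqpoll_Fpow) (auto simp: finite_cartesian_product_iff lessThan_empty_iff)
  also have "\<dots> \<approx> B"
    unfolding eqpoll_iff_card_of_ordIso
    using assms by (intro card_of_Times_infinite_simps(1) ordLess_imp_ordLeq
        finite_ordLess_infinite2) (auto simp: lessThan_empty_iff)
  finally show "fcoeffs p B \<lesssim> B" .
  have "inj_on (\<lambda>b x. if x = b then 1 else 0 :: nat) B"
    by (rule inj_onI) (metis zero_neq_one)
  moreover have "(\<lambda>b x. if x = b then 1 else 0) ` B \<subseteq> fcoeffs p B"
    using assms(2) unfolding fcoeffs_def by (auto split: if_splits)
  ultimately show "B \<lesssim> fcoeffs p B" unfolding lepoll_def by blast
qed

lemma card_fcoeffs:
  assumes "finite B" "p > 0"
  shows "finite (fcoeffs p B) \<and> card (fcoeffs p B) = p ^ card B"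
proof -
  have "bij_betw (\<lambda>c. restrict c B) (fcoeffs p B) (B \<rightarrow>\<^sub>E {..<p})"
  proof (rule bij_betwI[where g = "\<lambda>c b. if b \<in> B then c b else 0"])
    show "(\<lambda>c b. if b \<in> B then c b else 0) \<in> (B \<rightarrow>\<^sub>E {..<p}) \<rightarrow> fcoeffs p B"
      using assms unfolding fcoeffs_def by (auto simp: PiE_def Pi_def intro: finite_subset[of _ B])
    show "(\<lambda>b. if b \<in> B then restrict c B b else 0) = c" if "c \<in> fcoeffs p B" for c
      using that unfolding fcoeffs_def by (intro ext) auto
    show "restrict (\<lambda>b. if b \<in> B then c b else 0) B = c" if "c \<in> B \<rightarrow>\<^sub>E {..<p}" for c
      using that by (intro ext) (auto simp: PiE_def extensional_def)
  qed (auto simp: fcoeffs_def)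
  moreover have "finite (B \<rightarrow>\<^sub>E {..<p})" "card (B \<rightarrow>\<^sub>E {..<p}) = p ^ card B"
    using assms(1) by (auto intro!: finite_PiE simp: card_PiE)
  ultimately show ?thesis by (metis bij_betw_finite bij_betw_same_card)
qed

text \<open>Invariance of dimension by counting vectors: \<open>p ^ n\<close> determines
  \<open>n\<close>, and over an infinite basis there are as many vectors as basis elements.\<close>

lemma eqpoll_if_eqpoll_fcoeffs:
  assumes "fcoeffs p B \<approx> fcoeffs p C" "p \<ge> 2"
  shows "B \<approx> C"
proof (cases "finite B")
  case True
  hence B: "finite (fcoeffs p B)" "card (fcoeffs p B) = p ^ card B"
    using card_fcoeffs[of B p] assms(2) by auto
  have C: "finite C"
  proof (rule ccontr)
    assume "infinite C"
    with eqpoll_fcoeffs_infinite[OF this assms(2)] assms(1) B(1) show False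
      by (metis eqpoll_finite_iff)
  qed
  hence "p ^ card B = p ^ card C"
    using card_fcoeffs[of C p] B assms by (metis eqpoll_iff_card less_le_trans zero_less_numeral)
  hence "card B = card C" using assms(2) by (simp add: power_inject_exp)
  thus ?thesis using True C by (simp add: eqpoll_iff_card)
next
  case False
  hence B: "fcoeffs p B \<approx> B" using eqpoll_fcoeffs_infinite assms(2) by blast
  hence "infinite (fcoeffs p C)" using False assms(1) by (metis eqpoll_finite_iff)
  hence "infinite C" using card_fcoeffs[of C p] assms(2) by auto
  hence "fcoeffs p C \<approx> C" using eqpoll_fcoeffs_infinite assms(2) by blast
  thus ?thesis using B assms(1) by (meson eqpoll_sym eqpoll_trans)
qed

lemma nat_eq_if_dvd_diff:
  assumes "int p dvd int m - int n" "m < p" "n < p"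
  shows "m = n"
proof -
  have "int m mod int p = int n mod int p" using assms(1) by (simp add: mod_eq_dvd_iff)
  thus ?thesis using assms(2,3) by simp
qed

lemma zero_notin_val_image: "(0::'k::field) \<notin> val ` B"
proof
  assume "(0::'k) \<in> val ` B"
  then obtain b where "(0::'k) = val b" by blast
  thus False using val_nonzero[of b] by simp
qed

section \<open>Submodules of J as subspaces containing the p-th powers\<close>

context kummer_extension begin

definition cls :: "'k mgroup \<Rightarrow> 'k set" where "cls x = pcl p (val x)"

lemma pcl_eq_cls: "g \<noteq> 0 \<Longrightarrow> pcl p g = cls (mk g)"
  by (simp add: cls_def)

lemma pcl_1: "pcl p 1 = cls 0"
  by (simp add: cls_def)

lemma mem_cls: "y \<in> cls x \<longleftrightarrow> (\<exists>z. y = val z \<and> z - x \<in> powers)"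
proof
  assume "y \<in> cls x"
  then obtain d where d: "y = val x * d ^ p" "d \<noteq> 0" unfolding cls_def pcl_def by blast
  hence "y = val (mk y)" "mk y - x \<in> powers" unfolding mem_powers by (auto intro!: exI[of _ d])
  thus "\<exists>z. y = val z \<and> z - x \<in> powers" by blast
next
  assume "\<exists>z. y = val z \<and> z - x \<in> powers"
  then obtain z d where "y = val z" "d \<noteq> 0" "val z / val x = d ^ p" unfolding mem_powers by auto
  hence "y = val x * d ^ p" by (simp add: field_simps)
  thus "y \<in> cls x" unfolding cls_def pcl_def using \<open>d \<noteq> 0\<close> by blast
qed

lemma cls_eq_iff: "cls x = cls y \<longleftrightarrow> x - y \<in> powers"
proof
  assume "cls x = cls y"
  moreover have "val x \<in> cls x" unfolding mem_cls using grm.P_0 by (intro exI[of _ x]) simp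
  ultimately have "val x \<in> cls y" by simp
  then obtain z where "val x = val z" "z - y \<in> powers" unfolding mem_cls by blast
  thus "x - y \<in> powers" by (simp add: val_inject)
next
  assume *: "x - y \<in> powers"
  hence **: "y - x \<in> powers" using grm.P_neg by fastforce
  show "cls x = cls y"
  proof
    show "cls x \<subseteq> cls y" unfolding subset_iff mem_cls using grm.P_trans[OF _ *] by blast
    show "cls y \<subseteq> cls x" unfolding subset_iff mem_cls using grm.P_trans[OF _ **] by blast
  qed
qed

lemma jmul_cls: "jmul (cls x) (cls y) = cls (x + y)"
proof
  show "jmul (cls x) (cls y) \<subseteq> cls (x + y)"
  proof
    fix z assume "z \<in> jmul (cls x) (cls y)"
    then obtain u v where uv: "z = val u * val v" "u - x \<in> powers" "v - y \<in> powers"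
      unfolding jmul_def mem_cls by blast
    from grm.P_add[OF uv(2,3)] have "(u + v) - (x + y) \<in> powers" by (simp add: algebra_simps)
    thus "z \<in> cls (x + y)" unfolding mem_cls using uv(1) by (intro exI[of _ "u + v"]) simp
  qed
  show "cls (x + y) \<subseteq> jmul (cls x) (cls y)"
  proof
    fix z assume "z \<in> cls (x + y)"
    then obtain u where u: "z = val u" "u - (x + y) \<in> powers" unfolding mem_cls by blast
    have "val (u - y) \<in> cls x" unfolding mem_cls
      using u(2) by (intro exI[of _ "u - y"]) (simp add: algebra_simps)
    moreover have "val y \<in> cls y" unfolding mem_cls using grm.P_0 by (intro exI[of _ y]) simp
    moreover have "z = val (u - y) * val y" using u(1) by simp
    ultimately show "z \<in> jmul (cls x) (cls y)" unfolding jmul_def by blast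
  qed
qed

lemma msigma_act: "msigma x = act [:0, 1:] x"
  by (simp add: msigma.s_0)

lemma sigma_cls: "\<sigma> ` cls x = cls (msigma x)"
proof
  show "\<sigma> ` cls x \<subseteq> cls (msigma x)"
  proof
    fix z assume "z \<in> \<sigma> ` cls x"
    then obtain d where d: "z = \<sigma> (val x * d ^ p)" "d \<noteq> 0" unfolding cls_def pcl_def by blast
    hence "z = val (msigma x) * \<sigma> d ^ p" by (simp add: sigma_mult sigma_power)
    thus "z \<in> cls (msigma x)" unfolding cls_def pcl_def using sigma_nonzero[OF d(2)] by blast
  qed
  show "cls (msigma x) \<subseteq> \<sigma> ` cls x"
  proof
    fix z assume "z \<in> cls (msigma x)"
    then obtain d where d: "z = \<sigma> (val x) * d ^ p" "d \<noteq> 0" unfolding cls_def pcl_def by auto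
    obtain d' where d': "d = \<sigma> d'" using sigma_bij by (metis bij_pointE)
    have "d' \<noteq> 0" using d' d(2) sigma_0 by auto
    hence "val x * d' ^ p \<in> cls x" unfolding cls_def pcl_def by blast
    moreover have "z = \<sigma> (val x * d' ^ p)" unfolding d(1) d' by (simp add: sigma_mult sigma_power)
    ultimately show "z \<in> \<sigma> ` cls x" by blast
  qed
qed

lemma sigma_cls_fixed: "\<sigma> ` cls x = cls x \<longleftrightarrow> x \<in> grm.fixed"
proof -
  have "[:-1, 1:] = [:0, 1:] - (1 :: int poly)" by (simp add: one_pCons)
  hence "act [:-1, 1:] x = msigma x - x"
    by (simp only: grm.scale_left_diff_distrib grm.scale_one msigma_act)
  thus ?thesis unfolding sigma_cls cls_eq_iff grm.fixed_def by simp
qed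

lemma Jmod_cls: "Jmod p = cls ` UNIV"
proof
  show "Jmod p \<subseteq> cls ` UNIV" unfolding Jmod_def using pcl_eq_cls by blast
  show "cls ` UNIV \<subseteq> Jmod p" unfolding Jmod_def cls_def using val_nonzero by blast
qed

abbreviation admissible :: "'k mgroup set \<Rightarrow> bool" where
  "admissible M \<equiv> grm.subspace M \<and> powers \<subseteq> M"

lemma cls_mem_iff: "admissible M \<Longrightarrow> cls x \<in> cls ` M \<longleftrightarrow> x \<in> M"
  by (auto simp: cls_eq_iff intro: grm.subspace_congD)

lemma cls_image_inject: "admissible M \<Longrightarrow> admissible M' \<Longrightarrow> cls ` M = cls ` M' \<longleftrightarrow> M = M'"
  using cls_mem_iff[of M] cls_mem_iff[of M'] by (metis subsetI subset_antisym)

lemma cls_powers: "cls ` powers = {pcl p 1}"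
proof -
  have "cls x = cls 0" if "x \<in> powers" for x using that by (simp add: cls_eq_iff)
  thus ?thesis unfolding pcl_1 using grm.P_0 by blast
qed

lemma admissible_powers: "admissible powers"
  using grm.subspace_P by blast

lemma submod_cls:
  assumes "admissible M"
  shows "submod p \<sigma> (cls ` M)"
  unfolding submod_def
proof (intro conjI ballI)
  show "cls ` M \<subseteq> Jmod p" unfolding Jmod_cls by blast
  show "pcl p 1 \<in> cls ` M" unfolding pcl_1 using assms grm.subspace_0 by blast
  show "jmul A B \<in> cls ` M" if "A \<in> cls ` M" "B \<in> cls ` M" for A B
    using that assms grm.subspace_add by (auto simp: jmul_cls)
  show "\<sigma> ` A \<in> cls ` M" if "A \<in> cls ` M" for A
    using that assms grm.subspace_scale
      by (auto simp: sigma_cls msigma_act simp del: msigma.poly_act_pCons)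
qed

text \<open>\<open>submod\<close> asks only for closure under products and \<open>\<sigma>\<close>.
  Negative scalars come along because J has exponent \<open>p\<close>: \<open>k\<close> acts on
  classes as \<open>k mod p\<close>, that is, by a repeated product.\<close>

lemma submod_imp_cls_image:
  assumes "submod p \<sigma> N"
  shows "\<exists>M. admissible M \<and> N = cls ` M"
proof -
  define M where "M = {x. cls x \<in> N}"
  have zero: "0 \<in> M" using assms unfolding M_def submod_def by (simp add: pcl_1)
  have add: "x + y \<in> M" if "x \<in> M" "y \<in> M" for x y
    using that assms unfolding M_def submod_def by (auto simp: jmul_cls[symmetric])
  have sg: "msigma x \<in> M" if "x \<in> M" for x
    using that assms unfolding M_def submod_def by (auto simp: sigma_cls[symmetric])
  have nat: "mscale (int n) x \<in> M" if "x \<in> M" for n x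
  proof (induction n)
    case (Suc n)
    have "mscale (int (Suc n)) x = x + mscale (int n) x"
      by (simp add: mscale.scale_left_distrib)
    thus ?case using add[OF that Suc] by simp
  qed (simp add: zero)
  have int: "mscale k x \<in> M" if "x \<in> M" for k x
  proof -
    have "act [:k - k mod int p:] x \<in> powers"
      by (rule grm.multiple_act) (simp add: minus_mod_eq_mult_div)
    hence "cls (mscale k x) = cls (mscale (k mod int p) x)"
      by (simp only: cls_eq_iff act_const mscale.scale_left_diff_distrib)
    moreover have "k mod int p = int (nat (k mod int p))" using grm.p_pos by simp
    ultimately show ?thesis using nat[OF that, of "nat (k mod int p)"] unfolding M_def by simp
  qed
  have "act f x \<in> M" if "x \<in> M" for f x
    by (induction f) (auto simp: zero intro: add sg int that)
  hence "grm.subspace M" using zero add by (intro grm.subspaceI)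
  moreover have "powers \<subseteq> M"
  proof
    fix x assume "x \<in> powers"
    hence "cls x = cls 0" by (simp add: cls_eq_iff)
    thus "x \<in> M" using zero unfolding M_def by simp
  qed
  moreover have "N = cls ` M" using assms unfolding M_def submod_def Jmod_cls by auto
  ultimately show ?thesis by blast
qed

lemma setmul_cls:
  assumes "admissible M1" "admissible M2"
  shows "setmul (cls ` M1) (cls ` M2) = cls ` grm.span (M1 \<union> M2)"
proof -
  have s: "grm.span M1 = M1" "grm.span M2 = M2" using assms by (simp_all add: grm.span_eq_iff)
  have "grm.span (M1 \<union> M2) = {x + y | x y. x \<in> M1 \<and> y \<in> M2}" unfolding grm.span_Un s ..
  moreover have "setmul (cls ` M1) (cls ` M2) = cls ` {x + y | x y. x \<in> M1 \<and> y \<in> M2}"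
  proof -
    have "setmul (cls ` M1) (cls ` M2) = {cls (x + y) | x y. x \<in> M1 \<and> y \<in> M2}"
      unfolding setmul_def jmul_cls[symmetric] by blast
    also have "\<dots> = cls ` {x + y | x y. x \<in> M1 \<and> y \<in> M2}" by auto
    finally show ?thesis .
  qed
  ultimately show ?thesis by simp
qed

lemma idsum_cls_iff:
  assumes "admissible M1" "admissible M2" "admissible M"
  shows "idsum p (cls ` M1) (cls ` M2) (cls ` M) \<longleftrightarrow> M1 \<inter> M2 = powers \<and> grm.span (M1 \<union> M2) = M"
proof -
  \<comment> \<open>Images commute with this intersection because \<open>M1\<close> contains the
    p-th powers, so membership in \<open>M1\<close> depends only on the class.\<close>
  have Int: "cls ` M1 \<inter> cls ` M2 = cls ` (M1 \<inter> M2)"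
  proof
    show "cls ` M1 \<inter> cls ` M2 \<subseteq> cls ` (M1 \<inter> M2)"
    proof
      fix A assume "A \<in> cls ` M1 \<inter> cls ` M2"
      then obtain x where "A = cls x" "x \<in> M2" "cls x \<in> cls ` M1" by blast
      thus "A \<in> cls ` (M1 \<inter> M2)" using cls_mem_iff[OF assms(1)] by blast
    qed
  qed blast
  have "admissible (M1 \<inter> M2)" using assms grm.subspace_inter by auto
  note 1 = cls_image_inject[OF this admissible_powers]
  have "admissible (grm.span (M1 \<union> M2))"
    using assms grm.span_superset[of "M1 \<union> M2"] by auto
  note 2 = cls_image_inject[OF this assms(3)]
  show ?thesis
    unfolding idsum_def setmul_cls[OF assms(1,2)] cls_powers[symmetric] Int 1 2 ..
qed

lemma fixedpart_cls: "fixedpart \<sigma> (cls ` M) = cls ` (M \<inter> grm.fixed)"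
  unfolding fixedpart_def using sigma_cls_fixed by blast

lemma NJ_cls: "NJ p \<sigma> = cls ` grm.norms"
proof
  show "NJ p \<sigma> \<subseteq> cls ` grm.norms"
  proof
    fix A assume "A \<in> NJ p \<sigma>"
    then obtain g where "g \<noteq> 0" "A = pcl p (knorm p \<sigma> g)" unfolding NJ_def by blast
    hence "A = cls (act (norm_poly p) (mk g))" by (simp add: cls_def val_norm)
    thus "A \<in> cls ` grm.norms" using grm.norm_in_norms by blast
  qed
  show "cls ` grm.norms \<subseteq> NJ p \<sigma>"
  proof
    fix A assume "A \<in> cls ` grm.norms"
    then obtain x y where "A = cls x" "x - act (norm_poly p) y \<in> powers" unfolding grm.norms_def
      by blast
    hence "A = cls (act (norm_poly p) y)" by (simp add: cls_eq_iff)
    hence "A = pcl p (knorm p \<sigma> (val y))" by (simp add: cls_def val_norm)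
    thus "A \<in> NJ p \<sigma>" unfolding NJ_def using val_nonzero by blast
  qed
qed

text \<open>Two nonzero submodules both contain \<open>v\<close> and cannot intersect
  trivially.\<close>

lemma indecomposable_cls:
  assumes X: "admissible X" and v: "v \<in> X" "v \<notin> powers"
    and simple: "\<And>M. grm.subspace M \<Longrightarrow> powers \<subseteq> M \<Longrightarrow> M \<subseteq> X \<Longrightarrow> M \<noteq> powers \<Longrightarrow> v \<in> M"
  shows "indecomposable p \<sigma> (cls ` X)"
  unfolding indecomposable_def
proof (intro conjI allI impI)
  show "submod p \<sigma> (cls ` X)" using X by (rule submod_cls)
  show "cls ` X \<noteq> {pcl p 1}"
    using cls_image_inject[OF X admissible_powers] v cls_powers by auto
  fix N1 N2 assume *: "submod p \<sigma> N1 \<and> submod p \<sigma> N2 \<and> idsum p N1 N2 (cls ` X)"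
  obtain M1 where M1: "admissible M1" "N1 = cls ` M1" using * submod_imp_cls_image by blast
  obtain M2 where M2: "admissible M2" "N2 = cls ` M2" using * submod_imp_cls_image by blast
  have M: "M1 \<inter> M2 = powers" "grm.span (M1 \<union> M2) = X"
    using * idsum_cls_iff[OF M1(1) M2(1) X] M1(2) M2(2) by auto
  have "M1 \<subseteq> X" "M2 \<subseteq> X" using M(2) grm.span_superset[of "M1 \<union> M2"] by auto
  hence "M1 = powers \<or> M2 = powers" using simple[of M1] simple[of M2] M1(1) M2(1) M(1) v(2) by blast
  thus "N1 = {pcl p 1} \<or> N2 = {pcl p 1}" using M1(2) M2(2) cls_powers by blast
qed

section \<open>Bases over F_p and over F_p[G]\<close>

lemma bij_betw_fcoeffs:
  assumes "grm.fp_indep g B"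
  shows "bij_betw (\<lambda>c. cls (\<Sum>b | c b \<noteq> 0. act [:int (c b):] (g b))) (fcoeffs p B) (cls ` grm.fp_span g B)"
proof -
  have ext: "(\<Sum>b | c b \<noteq> 0. act [:int (c b):] (g b)) = (\<Sum>b\<in>S. act [:int (c b):] (g b))"
    if "finite S" "{b. c b \<noteq> 0} \<subseteq> S" for c S
    using that by (intro sum.mono_neutral_left) auto
  show ?thesis
  proof (intro bij_betw_imageI inj_onI subset_antisym subsetI)
    fix c c' assume c: "c \<in> fcoeffs p B" "c' \<in> fcoeffs p B"
      and eq: "cls (\<Sum>b | c b \<noteq> 0. act [:int (c b):] (g b))
          = cls (\<Sum>b | c' b \<noteq> 0. act [:int (c' b):] (g b))"
    \<comment> \<open>The union of the supports puts both combinations on one index set; their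
      difference is a relation, and coefficients below \<open>p\<close> that are congruent modulo
      \<open>p\<close> are equal.\<close>
    define S where "S = {b. c b \<noteq> 0} \<union> {b. c' b \<noteq> 0}"
    have S: "finite S" "S \<subseteq> B" using c unfolding S_def fcoeffs_def by auto
    have "(\<Sum>b\<in>S. act [:int (c b):] (g b)) - (\<Sum>b\<in>S. act [:int (c' b):] (g b)) \<in> powers"
      using eq ext[OF S(1), of c] ext[OF S(1), of c'] unfolding cls_eq_iff S_def by auto
    moreover have "[:int (c b) - int (c' b):] = [:int (c b):] - [:int (c' b):]" for b by simp
    hence "(\<Sum>b\<in>S. act [:int (c b) - int (c' b):] (g b))
        = (\<Sum>b\<in>S. act [:int (c b):] (g b)) - (\<Sum>b\<in>S. act [:int (c' b):] (g b))"
      by (simp only: grm.scale_left_diff_distrib sum_subtractf)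
    ultimately have *: "(\<Sum>b\<in>S. act [:int (c b) - int (c' b):] (g b)) \<in> powers" by (simp only:)
    have dvd: "int p dvd int (c b) - int (c' b)" if "b \<in> S" for b
      by (rule grm.fp_indepD[OF assms S * that])
    show "c = c'"
    proof
      fix b
      have "c b < p" "c' b < p" using c unfolding fcoeffs_def by auto
      thus "c b = c' b" using nat_eq_if_dvd_diff[OF dvd] by (cases "b \<in> S") (auto simp: S_def)
    qed
  next
    fix A assume "A \<in> (\<lambda>c. cls (\<Sum>b | c b \<noteq> 0. act [:int (c b):] (g b))) ` fcoeffs p B"
    then obtain c where c: "c \<in> fcoeffs p B" "A = cls (\<Sum>b | c b \<noteq> 0. act [:int (c b):] (g b))"
      by blast
    have "(\<Sum>b | c b \<noteq> 0. act [:int (c b):] (g b)) \<in> grm.fp_span g B"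
      unfolding grm.fp_span_def using c(1) grm.P_0 unfolding fcoeffs_def
      by (intro CollectI exI[of _ "{b. c b \<noteq> 0}"] exI[of _ "\<lambda>b. int (c b)"]) simp
    thus "A \<in> cls ` grm.fp_span g B" using c(2) by blast
  next
    fix A assume "A \<in> cls ` grm.fp_span g B"
    then obtain x S k
      where x: "A = cls x" "finite S" "S \<subseteq> B" "x - (\<Sum>b\<in>S. act [:k b:] (g b)) \<in> powers"
      unfolding grm.fp_span_def by blast
    define c where "c = (\<lambda>b. if b \<in> S then nat (k b mod int p) else 0)"
    have sub: "{b. c b \<noteq> 0} \<subseteq> S" unfolding c_def by auto
    have "c \<in> fcoeffs p B"
      using grm.p_pos sub x(2,3) unfolding fcoeffs_def
      by (auto simp: c_def nat_less_iff intro: finite_subset)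
    moreover have "(\<Sum>b\<in>S. act [:k b:] (g b) - act [:int (c b):] (g b)) \<in> powers"
    proof (rule grm.P_sum)
      fix b assume "b \<in> S"
      hence "int p dvd k b - int (c b)" using grm.p_pos by (simp add: c_def minus_mod_eq_mult_div)
      moreover have "[:k b - int (c b):] = [:k b:] - [:int (c b):]" by simp
      ultimately show "act [:k b:] (g b) - act [:int (c b):] (g b) \<in> powers"
        using grm.multiple_act by (metis grm.scale_left_diff_distrib)
    qed
    hence "x - (\<Sum>b\<in>S. act [:int (c b):] (g b)) \<in> powers"
      using grm.P_trans[OF x(4)] by (simp only: sum_subtractf)
    hence "A = cls (\<Sum>b | c b \<noteq> 0. act [:int (c b):] (g b))"
      unfolding x(1) cls_eq_iff ext[OF x(2) sub] .
    ultimately show "A \<in> (\<lambda>c. cls (\<Sum>b | c b \<noteq> 0. act [:int (c b):] (g b))) ` fcoeffs p B" by blast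
  qed
qed

lemma fp_basis_cls:
  assumes "grm.fp_indep (\<lambda>b. b) B"
  shows "fp_basis p (val ` B) (cls ` grm.fp_span (\<lambda>b. b) B)"
proof -
  have inj: "inj_on val B" by (simp add: inj_on_def val_inject)
  have indep: "grm.fp_indep mk (val ` B)"
    using assms inj by (intro grm.fp_indep_image) (simp_all add: val_inverse)
  have span: "grm.fp_span mk (val ` B) = grm.fp_span (\<lambda>b. b) B"
    using grm.fp_span_image[OF inj, of mk] by (simp add: val_inverse)
  have "pcl p (fcomb c) = cls (\<Sum>b | c b \<noteq> 0. act [:int (c b):] (mk b))"
    if "c \<in> fcoeffs p (val ` B)" for c
  proof -
    have "b \<noteq> 0" if "c b \<noteq> 0" for b using that \<open>c \<in> fcoeffs p (val ` B)\<close> unfolding fcoeffs_def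
      by auto
    hence "fcomb c = val (\<Sum>b | c b \<noteq> 0. act [:int (c b):] (mk b))"
      unfolding fcomb_def val_sum act_const by (intro prod.cong) auto
    thus ?thesis by (simp only: cls_def)
  qed
  hence "bij_betw (\<lambda>c. pcl p (fcomb c)) (fcoeffs p (val ` B)) (cls ` grm.fp_span (\<lambda>b. b) B)"
    using bij_betw_fcoeffs[OF indep] unfolding span by (simp cong: bij_betw_cong)
  thus ?thesis unfolding fp_basis_def using zero_notin_val_image by blast
qed

definition coeff_poly :: "('k \<Rightarrow> nat \<Rightarrow> nat) \<Rightarrow> 'k mgroup \<Rightarrow> int poly" where
  "coeff_poly c b = (\<Sum>i<p. monom (int (c (val b) i)) i)"

lemma coeff_coeff_poly: "coeff (coeff_poly c b) i = (if i < p then int (c (val b) i) else 0)"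
  by (simp add: coeff_poly_def coeff_sum)

text \<open>Any finite \<open>S\<close> containing the support is allowed, so that two coefficient
  families can be compared over the same index set.\<close>

lemma gcomb_eq:
  assumes c: "c \<in> gcoeffs p (val ` B)" and S: "finite S" "val -` supp2 c \<subseteq> S"
  shows "gcomb p \<sigma> c = val (\<Sum>b\<in>S. act (coeff_poly c b) b)"
proof -
  have "coeff_poly c b = 0" if "b \<notin> val -` supp2 c" for b
    using that by (auto simp: coeff_poly_def supp2_def)
  hence sum: "(\<Sum>b\<in>S. act (coeff_poly c b) b) = (\<Sum>b\<in>val -` supp2 c. act (coeff_poly c b) b)"
    using S by (intro sum.mono_neutral_right) auto
  have val: "val (act (coeff_poly c b) b) = (\<Prod>i<p. ((\<sigma> ^^ i) (val b)) ^ (c (val b) i))" for b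
    unfolding coeff_poly_def grm.scale_sum_left val_sum msigma.poly_act_monom by simp
  have "gcomb p \<sigma> c = (\<Prod>b\<in>val -` supp2 c. \<Prod>i<p. ((\<sigma> ^^ i) (val b)) ^ (c (val b) i))"
  proof -
    have im: "val ` (val -` supp2 c) = supp2 c"
      using c unfolding gcoeffs_def by (auto simp: image_vimage_eq)
    have inj: "inj_on val (val -` supp2 c)" by (simp add: inj_on_def val_inject)
    show ?thesis unfolding gcomb_def
      using prod.reindex[OF inj, of "\<lambda>y. \<Prod>i<p. ((\<sigma> ^^ i) y) ^ (c y i)"] unfolding im comp_def .
  qed
  thus ?thesis unfolding sum val_sum val .
qed

lemma finite_vimage_supp2: "c \<in> gcoeffs p (val ` B) \<Longrightarrow> finite (val -` supp2 c)"
  unfolding gcoeffs_def by (auto intro!: finite_vimageI injI simp: val_inject)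

lemma vimage_supp2_subset: "c \<in> gcoeffs p (val ` B) \<Longrightarrow> val -` supp2 c \<subseteq> B"
  unfolding gcoeffs_def by (force simp: val_inject)

lemma gcoeffsI:
  assumes "finite S" "S \<subseteq> B" "\<And>b i. b \<in> S \<Longrightarrow> k b i < p" "\<And>b i. b \<in> S \<Longrightarrow> p \<le> i \<Longrightarrow> k b i = 0"
  defines "c \<equiv> (\<lambda>y i. if y \<in> val ` S then k (mk y) i else 0)"
  shows "c \<in> gcoeffs p (val ` B)" "val -` supp2 c \<subseteq> S" "\<And>b i. b \<in> S \<Longrightarrow> c (val b) i = k b i"
proof -
  show cS: "c (val b) i = k b i" if "b \<in> S" for b i using that by (simp add: c_def val_inverse)
  have "supp2 c \<subseteq> val ` S" unfolding supp2_def c_def by auto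
  thus "val -` supp2 c \<subseteq> S" by (auto simp: val_inject)
  show "c \<in> gcoeffs p (val ` B)" unfolding gcoeffs_def
    using \<open>supp2 c \<subseteq> val ` S\<close> assms(1-4) grm.p_pos
    by (auto simp: c_def val_inverse intro: finite_subset[of _ "val ` S"])
qed

text \<open>Injectivity: by \<open>norm_indep_imp_free\<close> the difference of two coefficient
  polynomials is a relation, and reduced representatives are unique. Surjectivity: each coefficient
  has a reduced representative.\<close>

lemma free_basis_cls:
  assumes indep: "grm.fp_indep (\<lambda>b. act (norm_poly p) b) B"
  shows "free_basis p \<sigma> (val ` B) (cls ` grm.span (B \<union> powers))"
proof -
  have "bij_betw (\<lambda>c. pcl p (gcomb p \<sigma> c)) (gcoeffs p (val ` B)) (cls ` grm.span (B \<union> powers))"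
  proof (intro bij_betw_imageI inj_onI subset_antisym subsetI)
    fix c c' assume c: "c \<in> gcoeffs p (val ` B)" "c' \<in> gcoeffs p (val ` B)"
      and eq: "pcl p (gcomb p \<sigma> c) = pcl p (gcomb p \<sigma> c')"
    define S where "S = val -` supp2 c \<union> val -` supp2 c'"
    have S: "finite S" "S \<subseteq> B" unfolding S_def
      by (intro finite_UnI finite_vimage_supp2[OF c(1)] finite_vimage_supp2[OF c(2)])
        (intro Un_least vimage_supp2_subset[OF c(1)] vimage_supp2_subset[OF c(2)])
    have g: "gcomb p \<sigma> c = val (\<Sum>b\<in>S. act (coeff_poly c b) b)"
        "gcomb p \<sigma> c' = val (\<Sum>b\<in>S. act (coeff_poly c' b) b)"
      using gcomb_eq[OF c(1) S(1)] gcomb_eq[OF c(2) S(1)] unfolding S_def by auto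
    have "(\<Sum>b\<in>S. act (coeff_poly c b - coeff_poly c' b) b) \<in> powers"
      using eq unfolding g cls_def[symmetric] cls_eq_iff
      by (simp only: grm.scale_left_diff_distrib sum_subtractf)
    from grm.norm_indep_imp_free[OF indep S this]
    have rel: "coeff_poly c b - coeff_poly c' b \<in> relation_ideal p" if "b \<in> S" for b using that
      by blast
    show "c = c'"
    proof (intro ext)
      fix y i
      show "c y i = c' y i"
      proof (cases "y \<in> val ` S \<and> i < p")
        case False
        have "i \<ge> p \<Longrightarrow> c y i = 0 \<and> c' y i = 0" using c unfolding gcoeffs_def by auto
        moreover have "y \<in> val ` S" if "c y i \<noteq> 0 \<or> c' y i \<noteq> 0"
        proof -
          have y: "y \<in> supp2 c \<union> supp2 c'" using that unfolding supp2_def by auto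
          moreover have "supp2 c \<union> supp2 c' \<subseteq> val ` B" using c unfolding gcoeffs_def by auto
          ultimately obtain b where "y = val b" by blast
          thus ?thesis using y unfolding S_def by auto
        qed
        ultimately show ?thesis using False by (metis not_less)
      next
        case True
        then obtain b where b: "b \<in> S" "y = val b" "i < p" by blast
        have "int p dvd coeff (coeff_poly c b - coeff_poly c' b) i"
          by (rule relation_ideal_coeff_dvd[OF grm.p_pos rel[OF b(1)]]) (simp add: coeff_coeff_poly)
        hence "int p dvd int (c y i) - int (c' y i)" using b by (simp add: coeff_coeff_poly)
        moreover have "c y i < p" "c' y i < p" using c unfolding gcoeffs_def by auto
        ultimately show ?thesis by (rule nat_eq_if_dvd_diff)
      qed
    qed
  next
    fix A assume "A \<in> (\<lambda>c. pcl p (gcomb p \<sigma> c)) ` gcoeffs p (val ` B)"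
    then obtain c where c: "c \<in> gcoeffs p (val ` B)" "A = pcl p (gcomb p \<sigma> c)" by blast
    have "A = cls (\<Sum>b\<in>val -` supp2 c. act (coeff_poly c b) b)"
      using gcomb_eq[OF c(1) finite_vimage_supp2[OF c(1)] order_refl] c(2) unfolding cls_def by simp
    moreover have "(\<Sum>b\<in>val -` supp2 c. act (coeff_poly c b) b) \<in> grm.span (B \<union> powers)"
      using vimage_supp2_subset[OF c(1)] grm.subspace_span_P[of B]
      by (intro grm.subspace_sum grm.subspace_scale) auto
    ultimately show "A \<in> cls ` grm.span (B \<union> powers)" by blast
  next
    fix A assume "A \<in> cls ` grm.span (B \<union> powers)"
    then obtain x where x: "A = cls x" "x \<in> grm.span (B \<union> powers)" by blast
    from grm.span_P_explicit[OF x(2)] obtain S f where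
      S: "finite S" "S \<subseteq> B" "x - (\<Sum>b\<in>S. act (f b) b) \<in> powers" by (elim exE conjE)
    have "\<forall>b. \<exists>r. f b - r \<in> relation_ideal p \<and> (\<forall>i. 0 \<le> coeff r i \<and> coeff r i < int p)
          \<and> (\<forall>i\<ge>p. coeff r i = 0)"
      using relation_ideal_reduce[OF grm.p_pos] by blast
    then obtain r where r: "\<And>b. f b - r b \<in> relation_ideal p" "\<And>b i. 0 \<le> coeff (r b) i"
        "\<And>b i. coeff (r b) i < int p" "\<And>b i. i \<ge> p \<Longrightarrow> coeff (r b) i = 0" by metis
    define c where "c = (\<lambda>y i. if y \<in> val ` S then nat (coeff (r (mk y)) i) else 0)"
    have c: "c \<in> gcoeffs p (val ` B)" "val -` supp2 c \<subseteq> S"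
      "\<And>b i. b \<in> S \<Longrightarrow> c (val b) i = nat (coeff (r b) i)"
      unfolding c_def by (intro gcoeffsI[OF S(1,2), of "\<lambda>b i. nat (coeff (r b) i)"];
        use r in \<open>auto simp: nat_less_iff\<close>)+
    have cr: "coeff_poly c b = r b" if "b \<in> S" for b
      by (rule poly_eqI) (use that r(2,4) in \<open>auto simp: coeff_coeff_poly c(3)\<close>)
    have "(\<Sum>b\<in>S. act (f b - r b) b) \<in> powers"
      by (intro grm.P_sum grm.relation_ideal_act r(1))
    hence "(\<Sum>b\<in>S. act (f b) b) - (\<Sum>b\<in>S. act (r b) b) \<in> powers"
      by (simp only: grm.scale_left_diff_distrib sum_subtractf)
    from grm.P_trans[OF S(3) this] have "A = cls (\<Sum>b\<in>S. act (r b) b)" unfolding x(1) cls_eq_iff .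
    also have "(\<Sum>b\<in>S. act (r b) b) = (\<Sum>b\<in>S. act (coeff_poly c b) b)"
      by (rule sum.cong) (simp_all add: cr)
    also have "cls \<dots> = pcl p (gcomb p \<sigma> c)" unfolding cls_def gcomb_eq[OF c(1) S(1) c(2)] ..
    finally show "A \<in> (\<lambda>c. pcl p (gcomb p \<sigma> c)) ` gcoeffs p (val ` B)" using c(1) by blast
  qed
  thus ?thesis unfolding free_basis_def using zero_notin_val_image by blast
qed

text \<open>The converse of \<open>free_basis_cls\<close>. A relation between norms with scalars
  \<open>k b\<close> is a group ring relation whose coefficients are \<open>k b\<close> times the
  norm element; each of their \<open>p\<close> entries is \<open>k b mod p\<close>, and uniqueness
  of expansions makes it 0.\<close>

lemma free_basis_norm_indep:
  assumes "free_basis p \<sigma> (val ` B) Y"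
  shows "grm.fp_indep (\<lambda>b. act (norm_poly p) b) B"
  unfolding grm.fp_indep_def
proof (intro allI impI ballI, elim conjE)
  fix S k b
  assume S: "finite S" "S \<subseteq> B" "(\<Sum>b\<in>S. act [:k b:] (act (norm_poly p) b)) \<in> powers" "b \<in> S"
  have inj: "inj_on (\<lambda>c. pcl p (gcomb p \<sigma> c)) (gcoeffs p (val ` B))"
    using assms unfolding free_basis_def bij_betw_def by blast
  define k' where "k' = (\<lambda>b i. if i < p then nat (k b mod int p) else 0)"
  define c where "c = (\<lambda>y i. if y \<in> val ` S then k' (mk y) i else 0)"
  have c: "c \<in> gcoeffs p (val ` B)" "val -` supp2 c \<subseteq> S" "\<And>b i. b \<in> S \<Longrightarrow> c (val b) i = k' b i"
    unfolding c_def by (intro gcoeffsI[OF S(1,2), of k'];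
      use grm.p_pos in \<open>auto simp: k'_def nat_less_iff\<close>)+
  have cp: "coeff_poly c b = [:k b mod int p:] * norm_poly p" if "b \<in> S" for b
    by (rule poly_eqI) (use that grm.p_pos in \<open>auto simp: coeff_coeff_poly c(3) k'_def norm_poly_def coeff_sum\<close>)
  have "act [:k b:] (act (norm_poly p) b) - act (coeff_poly c b) b \<in> powers" if "b \<in> S" for b
  proof -
    have "[:k b - k b mod int p:] = [:k b:] - [:k b mod int p:]" by simp
    hence "act [:k b:] (act (norm_poly p) b) - act (coeff_poly c b) b
        = act [:k b - k b mod int p:] (act (norm_poly p) b)"
      by (simp only: cp[OF that] grm.scale_scale[symmetric] grm.scale_left_diff_distrib)
    thus ?thesis using grm.multiple_act[of "k b - k b mod int p"]
      by (simp only: minus_mod_eq_mult_div dvd_triv_left)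
  qed
  hence "(\<Sum>b\<in>S. act [:k b:] (act (norm_poly p) b) - act (coeff_poly c b) b) \<in> powers"
    by (rule grm.P_sum)
  hence "(\<Sum>b\<in>S. act (coeff_poly c b) b) \<in> powers"
    using grm.subspace_congD'[OF grm.subspace_P order_refl _ S(3)] by (simp only: sum_subtractf)
  hence "cls (\<Sum>b\<in>S. act (coeff_poly c b) b) = cls 0" by (simp add: cls_eq_iff)
  hence "pcl p (gcomb p \<sigma> c) = pcl p (gcomb p \<sigma> (\<lambda>_ _. 0))"
    unfolding cls_def gcomb_eq[OF c(1) S(1) c(2)] by (simp add: gcomb_def supp2_def)
  moreover have "(\<lambda>_ _. 0) \<in> gcoeffs p (val ` B)"
    unfolding gcoeffs_def supp2_def using grm.p_pos by simp
  ultimately have "c = (\<lambda>_ _. 0)" using inj_onD[OF inj] c(1) by blast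
  hence "k' b 0 = 0" using c(3)[OF S(4), of 0] by simp
  hence "nat (k b mod int p) = 0" using grm.p_pos by (simp add: k'_def)
  moreover have "k b mod int p \<ge> 0" using grm.p_pos by simp
  ultimately show "int p dvd k b" by (simp add: dvd_eq_mod_eq_0)
qed

lemma maximal_norm_indep:
  obtains B where "grm.fp_indep (\<lambda>b. act (norm_poly p) b) B"
    "\<And>w. act (norm_poly p) w \<in> grm.fp_span (\<lambda>b. act (norm_poly p) b) B"
proof -
  obtain B where B: "grm.fp_indep (\<lambda>b. act (norm_poly p) b) B"
      "\<And>A. grm.fp_indep (\<lambda>b. act (norm_poly p) b) A \<Longrightarrow> B \<subseteq> A \<Longrightarrow> A = B"
    using grm.maximal_fp_indep_exists[of "\<lambda>b. act (norm_poly p) b"] by blast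
  show ?thesis
    by (rule that[OF B(1) grm.maximal_fp_indep_span[OF B]])
qed

text \<open>N(J) lies in Y because it is spanned by the norms of elements of \<open>B\<close>;
  conversely, fixed elements of Y are norms by independence.\<close>

lemma free_part:
  assumes B: "grm.fp_indep (\<lambda>b. act (norm_poly p) b) B"
      "\<And>w. act (norm_poly p) w \<in> grm.fp_span (\<lambda>b. act (norm_poly p) b) B"
  shows "free_submod p \<sigma> (cls ` grm.span (B \<union> powers))"
    "fixedpart \<sigma> (cls ` grm.span (B \<union> powers)) = NJ p \<sigma>"
proof -
  have adm: "admissible (grm.span (B \<union> powers))" using grm.subspace_span_P[of B] by blast
  show "free_submod p \<sigma> (cls ` grm.span (B \<union> powers))"
    unfolding free_submod_def using submod_cls[OF adm] free_basis_cls[OF B(1)] by blast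
  have "grm.norms \<subseteq> grm.span (B \<union> powers)"
    unfolding grm.norms_eq_fp_span[OF B(2)]
    using grm.subspace_span_P[of B] by (intro grm.fp_span_subset grm.subspace_scale) auto
  hence "grm.span (B \<union> powers) \<inter> grm.fixed = grm.norms"
    using grm.span_Int_fixed_subset_norms[OF B(1)] grm.norms_subset_fixed by blast
  thus "fixedpart \<sigma> (cls ` grm.span (B \<union> powers)) = NJ p \<sigma>"
    unfolding fixedpart_cls NJ_cls by simp
qed

section \<open>The decomposition of J, according to whether \<open>\<xi>\<close> is a norm\<close>

lemma decomposition_cls:
  assumes X: "admissible X" "v \<in> X" "v \<in> grm.fixed" "v \<notin> grm.norms"
    and simple: "\<forall>M. grm.subspace M \<longrightarrow> powers \<subseteq> M \<longrightarrow> M \<subseteq> X \<longrightarrow> M \<noteq> powers \<longrightarrow> v \<in> M"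
    and short: "\<forall>x. act ([:-1, 1:] ^ 2) x \<in> powers
        \<longrightarrow> (\<exists>w\<in>X. act [:-1, 1:] x - act [:-1, 1:] w \<in> grm.norms)"
  shows "\<exists>Y Z W. submod p \<sigma> (cls ` X) \<and> submod p \<sigma> Y \<and> submod p \<sigma> Z \<and> submod p \<sigma> W
            \<and> idsum p Y Z W \<and> idsum p (cls ` X) W (Jmod p)
            \<and> indecomposable p \<sigma> (cls ` X)
            \<and> free_submod p \<sigma> Y \<and> fixedpart \<sigma> Y = NJ p \<sigma>
            \<and> (\<forall>A\<in>Z. \<sigma> ` A = A)"
proof -
  obtain B where B: "grm.fp_indep (\<lambda>b. act (norm_poly p) b) B"
      "\<And>w. act (norm_poly p) w \<in> grm.fp_span (\<lambda>b. act (norm_poly p) b) B"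
    using maximal_norm_indep by blast
  define Y where "Y = grm.span (B \<union> powers)"
  have Y: "admissible Y" unfolding Y_def using grm.subspace_span_P[of B] by blast
  obtain Z where Z: "grm.subspace Z" "powers \<subseteq> Z" "Z \<subseteq> grm.fixed" "Y \<inter> Z = powers"
      "X \<inter> grm.span (Y \<union> Z) = powers" "grm.span (X \<union> grm.span (Y \<union> Z)) = UNIV"
    using grm.decomposition[OF _ _ X(2-4) simple[rule_format] km.bottom_is_norm short[rule_format] B] X(1) unfolding Y_def by blast
  define W where "W = grm.span (Y \<union> Z)"
  have W: "admissible W" unfolding W_def using Y grm.span_superset[of "Y \<union> Z"] by auto
  have Z': "admissible Z" using Z by blast
  have U: "admissible UNIV" by simp
  have "idsum p (cls ` Y) (cls ` Z) (cls ` W)"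
    unfolding idsum_cls_iff[OF Y Z' W] using Z(4) W_def by blast
  moreover have "idsum p (cls ` X) (cls ` W) (Jmod p)"
    unfolding Jmod_cls idsum_cls_iff[OF X(1) W U] using Z(5,6) W_def by blast
  moreover have "indecomposable p \<sigma> (cls ` X)"
    using X grm.P_subset_norms by (intro indecomposable_cls[OF X(1,2) _ simple[rule_format]]) auto
  moreover have "\<forall>A\<in>cls ` Z. \<sigma> ` A = A"
    using Z(3) sigma_cls_fixed by blast
  moreover note submod_cls[OF X(1)] submod_cls[OF Y] submod_cls[OF Z'] submod_cls[OF W]
    free_part[OF B, folded Y_def]
  ultimately show ?thesis by blast
qed

definition mxi :: "'k mgroup" where "mxi = mk \<xi>"

lemma val_mxi [simp]: "val mxi = \<xi>"
  by (simp add: mxi_def xi_nonzero)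

lemma mxi_fixed: "mxi \<in> grm.fixed"
  unfolding mem_fixed by (intro exI[of _ 1]) (simp add: sigma_F xi xi_nonzero)

lemma t_malpha: "act [:-1, 1:] malpha = mxi"
  unfolding val_inject[symmetric] val_t by (simp add: sigma_alpha alpha_nonzero)

lemma decomposition_xi_norm:
  assumes "\<delta> \<noteq> 0" "knorm p \<sigma> \<delta> = \<xi>"
  shows "\<exists>X Y Z W. submod p \<sigma> X \<and> submod p \<sigma> Y \<and> submod p \<sigma> Z \<and> submod p \<sigma> W
            \<and> idsum p Y Z W \<and> idsum p X W (Jmod p)
            \<and> indecomposable p \<sigma> X \<and> fp_dim_eq p X 1
            \<and> free_submod p \<sigma> Y \<and> fixedpart \<sigma> Y = NJ p \<sigma>
            \<and> (\<forall>A\<in>Z. \<sigma> ` A = A)"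
proof -
  obtain \<gamma> where \<gamma>: "\<gamma> \<noteq> 0" "\<sigma> \<gamma> = \<gamma> * \<delta> ^ p" "\<And>\<beta> d. d \<noteq> 0 \<Longrightarrow> \<gamma> \<noteq> knorm p \<sigma> \<beta> * d ^ p"
    using xi_norm_imp_fixed_nonnorm[OF assms(2)] by blast
  define v where "v = mk \<gamma>"
  have [simp]: "val v = \<gamma>" using \<gamma>(1) by (simp add: v_def)
  have fixed: "v \<in> grm.fixed" unfolding mem_fixed using \<gamma>(1,2) assms(1) by (intro exI[of _ \<delta>]) simp
  have nonnorm: "v \<notin> grm.norms" unfolding mem_norms using \<gamma>(3) by auto
  hence vP: "v \<notin> powers" using grm.P_subset_norms by blast
  define X where "X = grm.span ({v} \<union> powers)"
  have X: "admissible X" "v \<in> X" unfolding X_def using grm.subspace_span_P[of "{v}"] by auto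
  have "mxi \<in> grm.norms" unfolding mem_norms using assms by (intro exI[of _ \<delta>] exI[of _ 1]) simp
  hence xi_norms: "act [:j:] mxi \<in> grm.norms" for j
    by (rule grm.subspace_scale[OF grm.subspace_norms])
  have short:
    "\<forall>x. act ([:-1, 1:] ^ 2) x \<in> powers \<longrightarrow> (\<exists>w\<in>X. act [:-1, 1:] x - act [:-1, 1:] w \<in> grm.norms)"
  proof (intro allI impI)
    fix x assume sq: "act ([:-1, 1:] ^ 2) x \<in> powers"
    obtain j where "act [:-1, 1:] x - act [:-1, 1:] (act [:j:] malpha) \<in> grm.norms"
      using km.image_t_Int_fixed[OF sq] p_gt_2 by auto
    hence "act [:-1, 1:] x - act [:j:] mxi \<in> grm.norms"
      by (simp only: grm.scale_left_commute[of "[:-1, 1:]" "[:j:]"] t_malpha)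
    \<comment> \<open>Here \<open>[\<xi>]\<close> lies in N(J), so the correction by a multiple of
      \<open>\<xi>\<close> disappears among the norms and \<open>w = 0\<close> serves.\<close>
    from grm.subspace_add[OF grm.subspace_norms this xi_norms[of j]]
    have "act [:-1, 1:] x - act [:-1, 1:] 0 \<in> grm.norms"
      by (simp only: diff_add_cancel grm.scale_zero_right diff_zero)
    moreover have "0 \<in> X" using X(1) grm.subspace_0 by blast
    ultimately show "\<exists>w\<in>X. act [:-1, 1:] x - act [:-1, 1:] w \<in> grm.norms" by blast
  qed
  have "\<forall>M. grm.subspace M \<longrightarrow> powers \<subseteq> M \<longrightarrow> M \<subseteq> X \<longrightarrow> M \<noteq> powers \<longrightarrow> v \<in> M"
    using grm.line_simple[OF fixed] unfolding X_def by blast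
  from decomposition_cls[OF X fixed nonnorm this short]
  obtain Y Z W where YZW: "submod p \<sigma> (cls ` X)" "submod p \<sigma> Y" "submod p \<sigma> Z" "submod p \<sigma> W"
    "idsum p Y Z W" "idsum p (cls ` X) W (Jmod p)" "indecomposable p \<sigma> (cls ` X)"
    "free_submod p \<sigma> Y" "fixedpart \<sigma> Y = NJ p \<sigma>" "\<forall>A\<in>Z. \<sigma> ` A = A" by (elim exE conjE)
  have "{v} \<subseteq> grm.fixed" using fixed by blast
  hence "X = grm.fp_span (\<lambda>b. b) {v}" unfolding X_def by (rule grm.span_P_fixed)
  with fp_basis_cls[OF grm.line_indep[OF vP]] have "fp_basis p (val ` {v}) (cls ` X)"
    by (simp only:)
  hence "fp_dim_eq p (cls ` X) 1" unfolding fp_dim_eq_def by (intro exI[of _ "val ` {v}"]) simp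
  with YZW show ?thesis by blast
qed

lemma decomposition_xi_nonnorm:
  assumes "\<nexists>g. g \<noteq> 0 \<and> knorm p \<sigma> g = \<xi>"
  shows "\<exists>X Y Z W. submod p \<sigma> X \<and> submod p \<sigma> Y \<and> submod p \<sigma> Z \<and> submod p \<sigma> W
            \<and> idsum p Y Z W \<and> idsum p X W (Jmod p)
            \<and> indecomposable p \<sigma> X \<and> fp_dim_eq p X 2
            \<and> free_submod p \<sigma> Y \<and> fixedpart \<sigma> Y = NJ p \<sigma>
            \<and> (\<forall>A\<in>Z. \<sigma> ` A = A)"
proof -
  have nonnorm: "mxi \<notin> grm.norms"
    unfolding mem_norms val_mxi using assms xi_norm_mod_powers by blast
  hence xiP: "mxi \<notin> powers" using grm.P_subset_norms by blast
  have t: "act [:-1, 1:] malpha - mxi \<in> powers" unfolding t_malpha using grm.P_0 by simp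
  note pair = t mxi_fixed xiP
  define X where "X = grm.span ({malpha, mxi} \<union> powers)"
  have X: "admissible X" "mxi \<in> X" "malpha \<in> X" unfolding X_def
    using grm.subspace_span_P[of "{malpha, mxi}"] by auto
  have short:
    "\<forall>x. act ([:-1, 1:] ^ 2) x \<in> powers \<longrightarrow> (\<exists>w\<in>X. act [:-1, 1:] x - act [:-1, 1:] w \<in> grm.norms)"
  proof (intro allI impI)
    fix x assume sq: "act ([:-1, 1:] ^ 2) x \<in> powers"
    obtain j where "act [:-1, 1:] x - act [:-1, 1:] (act [:j:] malpha) \<in> grm.norms"
      using km.image_t_Int_fixed[OF sq] p_gt_2 by auto
    \<comment> \<open>The multiple of \<open>\<alpha>\<close> is itself the required
      \<open>w\<close>; this is why X has to contain \<open>[\<alpha>]\<close> when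
      \<open>\<xi>\<close> is not a norm.\<close>
    moreover have "act [:j:] malpha \<in> X" using X(1,3) grm.subspace_scale by blast
    ultimately show "\<exists>w\<in>X. act [:-1, 1:] x - act [:-1, 1:] w \<in> grm.norms" by blast
  qed
  have "\<forall>M. grm.subspace M \<longrightarrow> powers \<subseteq> M \<longrightarrow> M \<subseteq> X \<longrightarrow> M \<noteq> powers \<longrightarrow> mxi \<in> M"
    using grm.pair_simple[OF pair] unfolding X_def by blast
  from decomposition_cls[OF X(1,2) mxi_fixed nonnorm this short]
  obtain Y Z W where YZW: "submod p \<sigma> (cls ` X)" "submod p \<sigma> Y" "submod p \<sigma> Z" "submod p \<sigma> W"
    "idsum p Y Z W" "idsum p (cls ` X) W (Jmod p)" "indecomposable p \<sigma> (cls ` X)"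
    "free_submod p \<sigma> Y" "fixedpart \<sigma> Y = NJ p \<sigma>" "\<forall>A\<in>Z. \<sigma> ` A = A" by (elim exE conjE)
  have "fp_basis p (val ` {malpha, mxi}) (cls ` X)"
    using fp_basis_cls[OF grm.pair_indep[OF pair]]
      unfolding grm.span_pair[OF pair, symmetric] X_def .
  moreover have "card (val ` {malpha, mxi}) = 2"
    using grm.pair_distinct[OF pair] by (subst card_image) (simp_all add: inj_on_def val_inject)
  ultimately have "fp_dim_eq p (cls ` X) 2"
    unfolding fp_dim_eq_def by (intro exI[of _ "val ` {malpha, mxi}"]) simp
  with YZW show ?thesis by blast
qed

text \<open>The norms of a free basis are independent, and maximality of \<open>Y\<close> makes them
  span N(J). Hence the F_p-coefficient families over \<open>B\<close> and over \<open>C\<close> are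
  both in bijection with N(J).\<close>

lemma maximal_free_rank:
  assumes Y: "free_submod p \<sigma> Y" "\<And>Y'. free_submod p \<sigma> Y' \<Longrightarrow> Y \<subseteq> Y' \<Longrightarrow> Y' = Y"
    and B: "free_basis p \<sigma> B Y" and C: "fp_basis p C (NJ p \<sigma>)"
  shows "B \<approx> C"
proof -
  define B' where "B' = mk ` B"
  have "0 \<notin> B" using B unfolding free_basis_def by blast
  hence "val (mk b) = b" if "b \<in> B" for b using that by (intro val_mk) blast
  hence BB: "B = val ` B'" unfolding B'_def image_image by simp
  have indep: "grm.fp_indep (\<lambda>b. act (norm_poly p) b) B'"
    using B unfolding BB by (rule free_basis_norm_indep)
  have Yeq: "Y = cls ` grm.span (B' \<union> powers)"
    using B free_basis_cls[OF indep] unfolding BB free_basis_def bij_betw_def by blast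
  \<comment> \<open>A larger set \<open>A\<close> with independent norms would generate a free
    module containing \<open>Y\<close>, hence equal to \<open>Y\<close>. A new element
    \<open>w\<close> would then be a combination of \<open>B'\<close>, giving a relation over
    \<open>A\<close> with coefficient 1 at \<open>w\<close>.\<close>
  have max: "A = B'" if A: "grm.fp_indep (\<lambda>b. act (norm_poly p) b) A" "B' \<subseteq> A" for A
  proof (rule ccontr)
    assume "A \<noteq> B'"
    then obtain w where w: "w \<in> A" "w \<notin> B'" using A(2) by blast
    have adm: "admissible (grm.span (A \<union> powers))" "admissible (grm.span (B' \<union> powers))"
      using grm.subspace_span_P[of A] grm.subspace_span_P[of B'] by blast+
    have "free_submod p \<sigma> (cls ` grm.span (A \<union> powers))"
      unfolding free_submod_def using submod_cls[OF adm(1)] free_basis_cls[OF A(1)] by blast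
    moreover have "Y \<subseteq> cls ` grm.span (A \<union> powers)"
      unfolding Yeq using A(2) by (intro image_mono grm.span_mono) blast
    ultimately have "cls ` grm.span (A \<union> powers) = cls ` grm.span (B' \<union> powers)" using Y(2) Yeq
      by blast
    hence "grm.span (A \<union> powers) = grm.span (B' \<union> powers)" using cls_image_inject[OF adm] by blast
    hence "w \<in> grm.span (B' \<union> powers)" using w(1) grm.subspace_span_P(3)[of A] by blast
    from grm.span_P_explicit[OF this] obtain S f where
      S: "finite S" "S \<subseteq> B'" "w - (\<Sum>b\<in>S. act (f b) b) \<in> powers" by (elim exE conjE)
    define f' where "f' = (\<lambda>b. if b = w then 1 else - f b)"
    have wS: "w \<notin> S" using S(2) w(2) by blast
    have "(\<Sum>b\<in>S. act (f' b) b) = (\<Sum>b\<in>S. - act (f b) b)"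
      by (rule sum.cong) (use wS in \<open>auto simp: f'_def\<close>)
    hence "(\<Sum>b\<in>insert w S. act (f' b) b) = w - (\<Sum>b\<in>S. act (f b) b)"
      using S(1) wS by (simp add: f'_def sum_negf)
    hence "(\<Sum>b\<in>insert w S. act (f' b) b) \<in> powers" using S(3) by simp
    from grm.norm_indep_imp_free[OF A(1) _ _ this]
    have "f' w \<in> relation_ideal p" using S(1,2) w(1) A(2) by blast
    hence "(1 :: int poly) \<in> relation_ideal p" by (simp add: f'_def)
    \<comment> \<open>The unit polynomial is reduced and its constant coefficient is not a multiple
      of \<open>p\<close>, so it cannot be a relation.\<close>
    hence "int p dvd coeff 1 0"
      using grm.p_pos
      by (intro relation_ideal_coeff_dvd) (auto simp: one_pCons coeff_pCons split: nat.splits)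
    thus False using p_gt_2 by simp
  qed
  have span: "act (norm_poly p) w \<in> grm.fp_span (\<lambda>b. act (norm_poly p) b) B'" for w
    by (rule grm.maximal_fp_indep_span[OF indep max])
  have "fcoeffs p B' \<approx> NJ p \<sigma>"
    using bij_betw_fcoeffs[OF indep] unfolding NJ_cls grm.norms_eq_fp_span[OF span] eqpoll_def
      by blast
  moreover have "fcoeffs p C \<approx> NJ p \<sigma>" using C unfolding fp_basis_def eqpoll_def by blast
  ultimately have "fcoeffs p B' \<approx> fcoeffs p C" by (meson eqpoll_sym eqpoll_trans)
  hence "B' \<approx> C" by (rule eqpoll_if_eqpoll_fcoeffs) (use p_gt_2 in simp)
  moreover have "B \<approx> B'" unfolding BB
    by (rule inj_on_image_eqpoll_self) (simp add: inj_on_def val_inject)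
  ultimately show ?thesis by (rule eqpoll_trans[rotated])
qed

end

theorem theorem1:
  fixes p :: nat and F :: "'k::field set" and \<xi> a \<alpha> :: 'k and \<sigma> :: "'k \<Rightarrow> 'k"
  assumes "prime p" and "p > 2"
    and "is_subfield F"
    and "of_nat p \<noteq> (0::'k)"
    and "\<xi> \<in> F" and "\<xi> ^ p = 1" and "\<xi> \<noteq> 1"
    and "a \<in> F" and "a \<noteq> 0" and "\<not> (\<exists>b\<in>F. b ^ p = a)"
    and "\<alpha> ^ p = a"
    and "\<forall>L. is_subfield L \<and> F \<subseteq> L \<and> \<alpha> \<in> L \<longrightarrow> L = UNIV"
    and "field_aut \<sigma>" and "\<forall>x\<in>F. \<sigma> x = x" and "\<sigma> \<alpha> = \<xi> * \<alpha>"
  shows "(\<exists>X Y Z W. submod p \<sigma> X \<and> submod p \<sigma> Y \<and> submod p \<sigma> Z \<and> submod p \<sigma> W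
            \<and> idsum p Y Z W \<and> idsum p X W (Jmod p)
            \<and> indecomposable p \<sigma> X
            \<and> ((\<exists>g. g \<noteq> 0 \<and> knorm p \<sigma> g = \<xi>) \<longrightarrow> fp_dim_eq p X 1)
            \<and> (\<not> (\<exists>g. g \<noteq> 0 \<and> knorm p \<sigma> g = \<xi>) \<longrightarrow> fp_dim_eq p X 2)
            \<and> free_submod p \<sigma> Y \<and> fixedpart \<sigma> Y = NJ p \<sigma>
            \<and> (\<forall>A\<in>Z. \<sigma> ` A = A))
       \<and> (\<forall>Y B C. free_submod p \<sigma> Y
            \<and> (\<forall>Y'. free_submod p \<sigma> Y' \<and> Y \<subseteq> Y' \<longrightarrow> Y' = Y)
            \<and> free_basis p \<sigma> B Y \<and> fp_basis p C (NJ p \<sigma>)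
            \<longrightarrow> B \<approx> C)"
proof -
  interpret kummer_extension p F \<xi> a \<alpha> \<sigma>
    by unfold_locales (use assms in blast)+
  show ?thesis
  proof (intro conjI allI impI, goal_cases)
    case 1
    show ?case
    proof (cases "\<exists>g. g \<noteq> 0 \<and> knorm p \<sigma> g = \<xi>")
      case True
      then obtain \<delta> where "\<delta> \<noteq> 0" "knorm p \<sigma> \<delta> = \<xi>" by blast
      from decomposition_xi_norm[OF this] show ?thesis by (simp only: True simp_thms)
    next
      case False
      from decomposition_xi_nonnorm[OF this] show ?thesis by (simp only: False simp_thms)
    qed
  next
    case (2 Y B C)
    thus ?case using maximal_free_rank[of Y B C] by blast
  qed
qed

end
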